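(* Let $(X,\mu)$ be one of the following: the Cantor space $\{0,1\}^\infty$ with the uniform Bernoulli measure, the discrete space $\mathbb{N}$ with counting measure, or $\mathbb{R}$ with Lebesgue measure. Let $\varepsilon>0$ be rational and let $f_0,f_1,f_2,\dots$ be a computable sequence of lower semicomputable functions $f_i:X\to[0,+\infty]$ such that $\int f_i(x)\,d\mu(x)\le\varepsilon$ for all $i$. Then for every rational $\varepsilon'>\varepsilon$ there exists a function $\varphi:X\to[0,+\infty]$ that is lower semicomputable relative to the oracle $\mathbf{0}'$ such that $$\liminf_{n\to\infty} f_n(x)\le\varphi(x)\ \text{for every } x\in X,\qquad \int\varphi(x)\,d\mu(x)\le\varepsilon'.$$ Moreover, a $\mathbf{0}'$-lower-semicomputation of $\varphi$ can be effectively constructed from $\varepsilon$, $\varepsilon'$ and an algorithm computing the sequence $(f_i)$.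
   Context: $\mathbf{0}'$ denotes the halting problem (the universal computably enumerable set). A function $f:X\to[0,+\infty]$ is lower semicomputable (relative to an oracle $A$) if it is the pointwise supremum of an ($A$-)computable sequence of basic functions of the form $r\chi_U$, where $r$ is a positive rational and $U$ is a basic open set (an interval $[x]=\{\omega\in\{0,1\}^\infty: x \text{ is a prefix of } \omega\}$ in Cantor space, a single point in $\mathbb{N}$, an open interval with rational endpoints in $\mathbb{R}$), and $\chi_U$ is the indicator function of $U$; equivalently, the sets $\{x: f(x)>r\}$ are ($A$-)effectively open uniformly in rational $r$. A computable sequence of lower semicomputable functions means the sequence of such approximations is computable uniformly in $i$. *)

theory Defs
  imports "HOL-Probability.Probability" "HOL-Library.Nat_Bijection"
begin

section \<open>Computability relative to an oracle\<close>

text \<open>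
  Partial recursive functions of one natural-number argument; several arguments are passed
  through the pairing function \<^const>\<open>prod_encode\<close>. The unrelativised notion is the one for the
  empty oracle.
\<close>

datatype program =
    Zero | Succ | First | Second | Query
  | Fork program program
  | Compose program program
  | PrimRec program program
  | Minimize program

inductive runs :: "nat set \<Rightarrow> program \<Rightarrow> nat \<Rightarrow> nat \<Rightarrow> bool" for A :: "nat set" where
  Zero: "runs A Zero n 0"
| Succ: "runs A Succ n (Suc n)"
| First: "runs A First n (fst (prod_decode n))"
| Second: "runs A Second n (snd (prod_decode n))"
| Query: "runs A Query n (if n \<in> A then 1 else 0)"
| Fork: "runs A p n a \<Longrightarrow> runs A q n b \<Longrightarrow> runs A (Fork p q) n (prod_encode (a, b))"
| Compose: "runs A q n m \<Longrightarrow> runs A p m k \<Longrightarrow> runs A (Compose p q) n k"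
| PrimRec_0: "runs A p a k \<Longrightarrow> runs A (PrimRec p q) (prod_encode (a, 0)) k"
| PrimRec_Suc:
    "runs A (PrimRec p q) (prod_encode (a, n)) m \<Longrightarrow>
     runs A q (prod_encode (a, prod_encode (n, m))) k \<Longrightarrow>
     runs A (PrimRec p q) (prod_encode (a, Suc n)) k"
| Minimize:
    "runs A p (prod_encode (a, n)) 0 \<Longrightarrow>
     (\<And>m. m < n \<Longrightarrow> runs A p (prod_encode (a, m)) (Suc (v m))) \<Longrightarrow>
     runs A (Minimize p) a n"

primrec code :: "program \<Rightarrow> nat" where
  "code Zero = prod_encode (0, 0)"
| "code Succ = prod_encode (1, 0)"
| "code First = prod_encode (2, 0)"
| "code Second = prod_encode (3, 0)"
| "code Query = prod_encode (4, 0)"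
| "code (Fork p q) = prod_encode (5, prod_encode (code p, code q))"
| "code (Compose p q) = prod_encode (6, prod_encode (code p, code q))"
| "code (PrimRec p q) = prod_encode (7, prod_encode (code p, code q))"
| "code (Minimize p) = prod_encode (8, code p)"

definition halting_problem :: "nat set" where
  "halting_problem = {prod_encode (code p, n) | p n. \<exists>m. runs {} p n m}"

lemma code_eq_iff [simp]: "code p = code q \<longleftrightarrow> p = q"
proof (induction p arbitrary: q)
qed (case_tac q; simp)+

inductive_cases runs_elims:
  "runs A Zero n k" "runs A Succ n k" "runs A First n k" "runs A Second n k" "runs A Query n k"
  "runs A (Fork p q) n k" "runs A (Compose p q) n k"
  "runs A (PrimRec p q) n k" "runs A (Minimize p) n k"

lemma runs_functional: "runs A p n k \<Longrightarrow> runs A p n l \<Longrightarrow> k = l"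
proof (induction arbitrary: l rule: runs.induct)
  case (Minimize p a n v)
  from Minimize.prems obtain w where
    w: "runs A p (prod_encode (a, l)) 0"
      "\<And>m. m < l \<Longrightarrow> runs A p (prod_encode (a, m)) (Suc (w m))"
    by (rule runs_elims(9)) blast
  have "\<not> l < n" using Minimize.IH(2)[OF _ w(1)] by auto
  moreover have "\<not> n < l" using Minimize.IH(1)[OF w(2)] by auto
  ultimately show ?case by simp
next
  case (Fork p n a q b)
  from Fork.prems show ?case by (rule runs_elims(6)) (use Fork.IH in blast)
next
  case (Compose q n m p k)
  from Compose.prems show ?case by (rule runs_elims(7)) (use Compose.IH in blast)
next
  case (PrimRec_0 p a k q)
  from PrimRec_0.prems show ?case by (rule runs_elims(8)) (auto dest: PrimRec_0.IH)
next
  case (PrimRec_Suc p q a n m k)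
  from PrimRec_Suc.prems show ?case by (rule runs_elims(8)) (auto dest: PrimRec_Suc.IH)
qed (auto elim: runs_elims(1-5))

section \<open>Lower semicomputable functions\<close>

definition pos_rat_of :: "nat \<Rightarrow> rat" where
  "pos_rat_of n = (case prod_decode n of (a, b) \<Rightarrow> of_nat (Suc a) / of_nat (Suc b))"

definition rat_of :: "nat \<Rightarrow> rat" where
  "rat_of n = (case prod_decode n of (a, b) \<Rightarrow> of_int (int_decode a) / of_nat (Suc b))"

text \<open>
  \<open>B\<close> is a numbering of the basic open sets. Number \<open>0\<close> codes the absence of a basic function:
  enumerations may pause, so that the supremum may range over finitely many or no basic functions.
  Otherwise the zero function would not be lower semicomputable.
\<close>

definition basic_fun :: "(nat \<Rightarrow> 'a set) \<Rightarrow> nat \<Rightarrow> 'a \<Rightarrow> ennreal" where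
  "basic_fun B m x =
     (case m of
        0 \<Rightarrow> 0
      | Suc j \<Rightarrow> (case prod_decode j of
          (r, u) \<Rightarrow> ennreal (real_of_rat (pos_rat_of r)) * indicator (B u) x))"

definition lower_semicomputes ::
    "nat set \<Rightarrow> (nat \<Rightarrow> 'a set) \<Rightarrow> program \<Rightarrow> ('a \<Rightarrow> ennreal) \<Rightarrow> bool" where
  "lower_semicomputes A B p f \<longleftrightarrow>
     (\<exists>s. (\<forall>k. runs A p k (s k)) \<and> (\<forall>x. f x = (SUP k. basic_fun B (s k) x)))"

definition lower_semicomputable ::
    "nat set \<Rightarrow> (nat \<Rightarrow> 'a set) \<Rightarrow> ('a \<Rightarrow> ennreal) \<Rightarrow> bool" where
  "lower_semicomputable A B f \<longleftrightarrow> (\<exists>p. lower_semicomputes A B p f)"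

definition lower_semicomputes_seq ::
    "nat set \<Rightarrow> (nat \<Rightarrow> 'a set) \<Rightarrow> program \<Rightarrow> (nat \<Rightarrow> 'a \<Rightarrow> ennreal) \<Rightarrow> bool" where
  "lower_semicomputes_seq A B p f \<longleftrightarrow>
     (\<exists>s. (\<forall>i k. runs A p (prod_encode (i, k)) (s i k)) \<and>
          (\<forall>i x. f i x = (SUP k. basic_fun B (s i k) x)))"

definition lower_semicomputable_seq ::
    "nat set \<Rightarrow> (nat \<Rightarrow> 'a set) \<Rightarrow> (nat \<Rightarrow> 'a \<Rightarrow> ennreal) \<Rightarrow> bool" where
  "lower_semicomputable_seq A B f \<longleftrightarrow> (\<exists>p. lower_semicomputes_seq A B p f)"

section \<open>The three spaces\<close>

definition cylinder :: "bool list \<Rightarrow> (nat \<Rightarrow> bool) set" where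
  "cylinder w = {\<omega>. \<forall>i < length w. \<omega> i = w ! i}"

text \<open>The pair \<open>(n, m)\<close> codes the string of the \<open>n\<close> lowest binary digits of \<open>m\<close>.\<close>

definition string_of :: "nat \<Rightarrow> bool list" where
  "string_of u = (case prod_decode u of (n, m) \<Rightarrow> map (bit m) [0..<n])"

definition cantor_basic :: "nat \<Rightarrow> (nat \<Rightarrow> bool) set" where
  "cantor_basic u = cylinder (string_of u)"

definition cantor_measure :: "(nat \<Rightarrow> bool) measure" where
  "cantor_measure = PiM UNIV (\<lambda>_. measure_pmf (bernoulli_pmf (1/2)))"

definition nat_basic :: "nat \<Rightarrow> nat set" where
  "nat_basic u = {u}"

definition real_basic :: "nat \<Rightarrow> real set" where
  "real_basic u =
     (case prod_decode u of (a, b) \<Rightarrow> {real_of_rat (rat_of a) <..< real_of_rat (rat_of b)})"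

lemma range_pos_rat_of: "range pos_rat_of = {0<..}"
proof (intro equalityI subsetI)
  fix q :: rat assume "q \<in> {0<..}"
  then obtain a b :: int where ab: "q = Fract a b" "b > 0" "a > 0"
    by (cases q) (auto simp: zero_less_Fract_iff)
  then have "q = pos_rat_of (prod_encode (nat (a - 1), nat (b - 1)))"
    by (simp add: pos_rat_of_def Fract_of_int_quotient)
  then show "q \<in> range pos_rat_of" by blast
qed (auto simp: pos_rat_of_def split: prod.splits intro!: divide_pos_pos add_pos_nonneg)

lemma surj_rat_of: "surj rat_of"
proof (rule surjI)
  fix q :: rat
  obtain a b :: int where ab: "quotient_of q = (a, b)" by force
  have "b > 0" and q: "q = of_int a / of_int b"
    using ab by (simp_all add: quotient_of_denom_pos quotient_of_div)
  then have "rat_of (prod_encode (int_encode a, nat (b - 1))) = q"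
    by (simp add: rat_of_def)
  then show "rat_of (case quotient_of q of (a, b) \<Rightarrow> prod_encode (int_encode a, nat (b - 1))) = q"
    by (simp add: ab)
qed

lemma surj_string_of: "surj string_of"
proof (rule surjI)
  fix w
  show "string_of (prod_encode (length w, horner_sum of_bool 2 w)) = w"
    by (auto simp: string_of_def bit_horner_sum_bit_iff intro: nth_equalityI)
qed

end

theory Submission
  imports Defs
begin

text \<open>
  Choose \<open>0 = K 0 < K 1 < \<dots>\<close> and let \<open>\<phi>\<close> be the supremum of the block minima
  \<open>v n = min {f k | K n \<le> k < K (n + 1)}\<close>; clearly \<open>liminf f \<le> \<phi>\<close>. The invariant is that
  \<open>\<integral> max (v 0, \<dots>, v (n - 1), f i) \<le> c n\<close> for all \<open>i \<ge> K n\<close>, where \<open>c n\<close> increases strictly from \<open>\<epsilon>\<close> and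
  stays below \<open>\<epsilon>'\<close>. A next threshold exists: as \<open>k\<close> grows, \<open>\<integral> min {f j | K n \<le> j < k}\<close> decreases to a
  limit, so for large \<open>k\<close> taking the minimum with a further \<open>f i\<close> loses little, which means that
  most of the new block minimum already lies under \<open>f i\<close>. Whether \<open>k\<close> is a valid threshold is a \<open>\<Pi>\<^sub>1\<close>
  question because integrals of lower semicomputable functions can be enumerated from below, so
  \<open>\<zero>'\<close> finds the least valid one.
\<close>

section \<open>Uniformly computable functionals\<close>

text \<open>The infimum over an infinite tail of lower semicomputable functions need not even be
  lower semicontinuous, so the tails inside the liminf cannot be enumerated directly. A minimum of
  finitely many functions can, because its superlevel sets are finite intersections of open sets.
  Replacing tails by finite blocks enlarges the function, and the gap between \<epsilon> and
  \<epsilon>' pays for the enlargement. The later \<open>f i\<close> belongs to the invariant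
  because a bound on the finished blocks alone says nothing about their maximum with the next block.

  A threshold is judged against infinitely many i, yet a violation is witnessed by one i and one
  finite stage, hence by a single halting computation. For the effective version the code of that
  computation must itself be computed from the given program; this is why programs with a hole are
  used. The spaces enter only through a decidable formal inclusion of basic sets and grids of cells
  of equal measure.\<close>

abbreviation pfst :: "nat \<Rightarrow> nat" where "pfst n \<equiv> fst (prod_decode n)"
abbreviation psnd :: "nat \<Rightarrow> nat" where "psnd n \<equiv> snd (prod_decode n)"

primrec plug :: "program \<Rightarrow> program \<Rightarrow> program" where
  "plug p Zero = Zero"
| "plug p Succ = Succ"
| "plug p First = First"
| "plug p Second = Second"
| "plug p Query = p"
| "plug p (Fork r s) = Fork (plug p r) (plug p s)"
| "plug p (Compose r s) = Compose (plug p r) (plug p s)"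
| "plug p (PrimRec r s) = PrimRec (plug p r) (plug p s)"
| "plug p (Minimize r) = Minimize (plug p r)"

lemma plug_Query: "plug Query R = R"
  by (induction R) auto

definition realizes :: "program \<Rightarrow> ((nat \<Rightarrow> nat) \<Rightarrow> nat \<Rightarrow> nat) \<Rightarrow> bool" where
  "realizes R \<Phi> \<longleftrightarrow>
     (\<forall>A p g n. (\<forall>m. runs A p m (g m)) \<longrightarrow> runs A (plug p R) n (\<Phi> g n))"

text \<open>
  Using \<^const>\<open>Query\<close> as a hole for a program computing \<open>g\<close> serves two purposes: with a program
  for an enumeration it gives halting questions uniformly in that program, and with
  \<^const>\<open>Query\<close> itself it gives computations with a genuine oracle.
\<close>

definition recursive :: "((nat \<Rightarrow> nat) \<Rightarrow> nat \<Rightarrow> nat) \<Rightarrow> bool" where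
  "recursive \<Phi> \<longleftrightarrow> (\<exists>R. realizes R \<Phi>)"

definition decidable :: "((nat \<Rightarrow> nat) \<Rightarrow> nat \<Rightarrow> bool) \<Rightarrow> bool" where
  "decidable P \<longleftrightarrow> recursive (\<lambda>g n. of_bool (P g n))"

lemma realizesD:
  "realizes R \<Phi> \<Longrightarrow> (\<And>m. runs A p m (g m)) \<Longrightarrow> runs A (plug p R) n (\<Phi> g n)"
  by (auto simp: realizes_def)

lemma recursive_id: "recursive (\<lambda>g n. n)"
proof -
  \<comment> \<open>No constructor is the identity; splitting the argument as a pair and pairing the
    halves again yields it.\<close>
  have "runs A (Fork First Second) n n" for A n
    using runs.Fork[OF runs.First runs.Second, of A n] by simp
  then have "realizes (Fork First Second) (\<lambda>g n. n)" by (auto simp: realizes_def)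
  then show ?thesis by (auto simp: recursive_def)
qed

lemma recursive_compose:
  assumes "recursive F" "recursive G"
  shows "recursive (\<lambda>g n. F g (G g n))"
proof -
  from assms obtain R S where R: "realizes R F" and S: "realizes S G"
    by (auto simp: recursive_def)
  have "realizes (Compose R S) (\<lambda>g n. F g (G g n))"
    unfolding realizes_def plug.simps
    by (blast intro: runs.Compose[OF realizesD[OF S] realizesD[OF R]])
  then show ?thesis by (auto simp: recursive_def)
qed

lemma recursive_Suc: "recursive F \<Longrightarrow> recursive (\<lambda>g n. Suc (F g n))"
proof (rule recursive_compose[of "\<lambda>g. Suc"])
  show "recursive (\<lambda>g. Suc)" unfolding recursive_def realizes_def
    by (rule exI[of _ Succ]) (auto intro: runs.Succ)
qed

lemma recursive_pfst: "recursive F \<Longrightarrow> recursive (\<lambda>g n. pfst (F g n))"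
proof (rule recursive_compose[of "\<lambda>g. pfst"])
  show "recursive (\<lambda>g. pfst)" unfolding recursive_def realizes_def
    by (rule exI[of _ First]) (auto intro: runs.First)
qed

lemma recursive_psnd: "recursive F \<Longrightarrow> recursive (\<lambda>g n. psnd (F g n))"
proof (rule recursive_compose[of "\<lambda>g. psnd"])
  show "recursive (\<lambda>g. psnd)" unfolding recursive_def realizes_def
    by (rule exI[of _ Second]) (auto intro: runs.Second)
qed

lemma recursive_apply: "recursive F \<Longrightarrow> recursive (\<lambda>g n. g (F g n))"
proof (rule recursive_compose[of "\<lambda>g. g"])
  show "recursive (\<lambda>g. g)" unfolding recursive_def realizes_def
    by (rule exI[of _ Query]) auto
qed

lemma recursive_zero: "recursive (\<lambda>g n. 0)"
  unfolding recursive_def realizes_def by (rule exI[of _ Zero]) (auto intro: runs.Zero)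

lemma recursive_const: "recursive (\<lambda>g n. c)"
  by (induction c) (auto intro: recursive_zero recursive_Suc)

lemma recursive_pair:
  assumes "recursive F" "recursive G"
  shows "recursive (\<lambda>g n. prod_encode (F g n, G g n))"
proof -
  from assms obtain R S where "realizes R F" "realizes S G" by (auto simp: recursive_def)
  then have "realizes (Fork R S) (\<lambda>g n. prod_encode (F g n, G g n))"
    by (auto simp: realizes_def intro: runs.Fork)
  then show ?thesis by (auto simp: recursive_def)
qed

lemma recursive_compose2:
  assumes "recursive (\<lambda>g z. H g (pfst z) (psnd z))" "recursive F" "recursive G"
  shows "recursive (\<lambda>g n. H g (F g n) (G g n))"
  using recursive_compose[OF assms(1) recursive_pair[OF assms(2,3)]] by simp

lemma recursive_rec_nat:
  assumes "recursive F" "recursive (\<lambda>g z. H g (pfst z) (pfst (psnd z)) (psnd (psnd z)))" "recursive G"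
  shows "recursive (\<lambda>g n. rec_nat (F g n) (\<lambda>k r. H g n k r) (G g n))"
proof -
  from assms(1,2) obtain R S where R: "realizes R F"
    and S: "realizes S (\<lambda>g z. H g (pfst z) (pfst (psnd z)) (psnd (psnd z)))"
    by (auto simp: recursive_def)
  have runs: "runs A (PrimRec (plug p R) (plug p S)) (prod_encode (a, n))
      (rec_nat (F g a) (H g a) n)" if "\<And>m. runs A p m (g m)" for A p g a n
  proof (induction n)
    case 0
    show ?case using realizesD[OF R that] by (auto intro: runs.PrimRec_0)
  next
    case (Suc n)
    show ?case using realizesD[OF S that, of "prod_encode (a, prod_encode (n, rec_nat (F g a) (H g a) n))"]
      by (auto intro: runs.PrimRec_Suc[OF Suc])
  qed
  have "realizes (PrimRec R S) (\<lambda>g z. rec_nat (F g (pfst z)) (\<lambda>k r. H g (pfst z) k r) (psnd z))"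
    unfolding realizes_def
  proof (intro allI impI)
    fix A p g n assume "\<forall>m. runs A p m (g m)"
    then show "runs A (plug p (PrimRec R S)) n (rec_nat (F g (pfst n)) (\<lambda>k r. H g (pfst n) k r) (psnd n))"
      using runs[of A p g "pfst n" "psnd n"] by simp
  qed
  then have "recursive (\<lambda>g z. rec_nat (F g (pfst z)) (\<lambda>k r. H g (pfst z) k r) (psnd z))"
    by (auto simp: recursive_def)
  from recursive_compose[OF this recursive_pair[OF recursive_id assms(3)]] show ?thesis by simp
qed

lemmas recursive_basics =
  recursive_const recursive_id recursive_Suc recursive_pfst recursive_psnd recursive_pair
  recursive_apply

section \<open>Arithmetic, bounded quantifiers and case distinctions\<close>

lemma recursive_add:
  assumes "recursive F" "recursive G"
  shows "recursive (\<lambda>g n. F g n + G g n)"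
proof -
  have "rec_nat a (\<lambda>k r. Suc r) b = a + b" for a b :: nat by (induction b) auto
  moreover have "recursive (\<lambda>g n. rec_nat (F g n) (\<lambda>k r. Suc r) (G g n))"
    by (intro recursive_rec_nat recursive_basics assms)
  ultimately show ?thesis by simp
qed

lemma recursive_diff:
  assumes "recursive F" "recursive G"
  shows "recursive (\<lambda>g n. F g n - G g n)"
proof -
  have pred: "rec_nat 0 (\<lambda>k r. k) b = b - 1" for b :: nat by (cases b) auto
  have "rec_nat a (\<lambda>k r. rec_nat 0 (\<lambda>k r. k) r) b = a - b" for a b :: nat
    by (induction b) (auto simp: pred)
  moreover have "recursive (\<lambda>g n. rec_nat (F g n) (\<lambda>k r. rec_nat 0 (\<lambda>k r. k) r) (G g n))"
    by (intro recursive_rec_nat recursive_basics assms)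
  ultimately show ?thesis by simp
qed

lemma recursive_mult:
  assumes "recursive F" "recursive G"
  shows "recursive (\<lambda>g n. F g n * G g n)"
proof -
  have "rec_nat 0 (\<lambda>k r. r + a) b = a * b" for a b :: nat by (induction b) auto
  moreover have "recursive (\<lambda>g n. rec_nat 0 (\<lambda>k r. r + F g n) (G g n))"
    by (intro recursive_rec_nat recursive_basics recursive_add recursive_compose[OF assms(1)] assms)
  ultimately show ?thesis by simp
qed

lemma recursive_power:
  assumes "recursive F" "recursive G"
  shows "recursive (\<lambda>g n. F g n ^ G g n)"
proof -
  have "rec_nat 1 (\<lambda>k r. a * r) b = a ^ b" for a b :: nat by (induction b) auto
  moreover have "recursive (\<lambda>g n. rec_nat 1 (\<lambda>k r. F g n * r) (G g n))"
    by (intro recursive_rec_nat recursive_basics recursive_mult recursive_compose[OF assms(1)] assms)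
  ultimately show ?thesis by simp
qed

lemma recursive_sum:
  assumes "recursive (\<lambda>g z. H g (pfst z) (psnd z))" "recursive G"
  shows "recursive (\<lambda>g n. \<Sum>k<G g n. H g n k)"
proof -
  have eq: "(\<Sum>k<b. h k) = rec_nat 0 (\<lambda>k r. r + h k) b" for h and b :: nat
    by (induction b) auto
  show ?thesis unfolding eq
    by (intro recursive_rec_nat recursive_basics recursive_add recursive_compose2[OF assms(1)] assms)
qed

lemma decidable_le:
  assumes "recursive F" "recursive G"
  shows "decidable (\<lambda>g n. F g n \<le> G g n)"
proof -
  have "(of_bool (a \<le> b) :: nat) = 1 - (a - b)" for a b :: nat by auto
  then show ?thesis unfolding decidable_def
    by (simp only:) (intro recursive_basics recursive_diff assms)
qed

lemma decidable_not:
  assumes "decidable P"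
  shows "decidable (\<lambda>g n. \<not> P g n)"
proof -
  have "(of_bool (\<not> Q) :: nat) = 1 - of_bool Q" for Q by auto
  then show ?thesis using assms unfolding decidable_def
    by (simp only:) (intro recursive_basics recursive_diff)
qed

lemma decidable_conj:
  assumes "decidable P" "decidable Q"
  shows "decidable (\<lambda>g n. P g n \<and> Q g n)"
  using assms unfolding decidable_def of_bool_conj by (rule recursive_mult)

lemma decidable_disj:
  assumes "decidable P" "decidable Q"
  shows "decidable (\<lambda>g n. P g n \<or> Q g n)"
  using decidable_not[OF decidable_conj[OF assms[THEN decidable_not]]] by simp

lemma decidable_imp:
  assumes "decidable P" "decidable Q"
  shows "decidable (\<lambda>g n. P g n \<longrightarrow> Q g n)"
  unfolding imp_conv_disj by (intro decidable_disj decidable_not assms)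

lemma decidable_less:
  assumes "recursive F" "recursive G"
  shows "decidable (\<lambda>g n. F g n < G g n)"
  using decidable_not[OF decidable_le[OF assms(2,1)]] by (simp add: not_le)

lemma decidable_eq:
  assumes "recursive F" "recursive G"
  shows "decidable (\<lambda>g n. F g n = G g n)"
  unfolding order_eq_iff[where ?'a = nat] by (intro decidable_conj decidable_le assms)

lemma decidable_ex:
  assumes "decidable (\<lambda>g z. P g (pfst z) (psnd z))" "recursive G"
  shows "decidable (\<lambda>g n. \<exists>k<G g n. P g n k)"
proof -
  have eq: "(\<exists>k<b. Q k) \<longleftrightarrow> 1 \<le> (\<Sum>k<b. of_bool (Q k) :: nat)" for b :: nat and Q
    by (auto simp: Suc_le_eq card_gt_0_iff)
  show ?thesis unfolding eq
    by (intro decidable_le recursive_const recursive_sum assms(1)[unfolded decidable_def] assms(2))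
qed

lemma decidable_all:
  assumes "decidable (\<lambda>g z. P g (pfst z) (psnd z))" "recursive G"
  shows "decidable (\<lambda>g n. \<forall>k<G g n. P g n k)"
  using decidable_not[OF decidable_ex[OF decidable_not[OF assms(1)] assms(2)]] by simp

lemma decidable_compose2:
  "decidable (\<lambda>g z. P g (pfst z) (psnd z)) \<Longrightarrow> recursive F \<Longrightarrow> recursive G \<Longrightarrow>
   decidable (\<lambda>g n. P g (F g n) (G g n))"
  unfolding decidable_def by (rule recursive_compose2)

lemma recursive_if:
  assumes "decidable P" "recursive F" "recursive G"
  shows "recursive (\<lambda>g n. if P g n then F g n else G g n)"
proof -
  have "(if Q then a else b) = of_bool Q * a + of_bool (\<not> Q) * b" for Q and a b :: nat by auto
  then show ?thesis using assms decidable_not[OF assms(1)] unfolding decidable_def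
    by (simp only:) (intro recursive_add recursive_mult)
qed

lemma recursive_of_bool: "decidable P \<Longrightarrow> recursive (\<lambda>g n. of_bool (P g n))"
  by (simp add: decidable_def)

text \<open>The quotient a div b counts the positive multiples of b up to a, and for b > 0 there are
  at most a of them. The guard \<open>0 < b\<close> reproduces the value 0 of division by
  zero.\<close>

lemma recursive_div:
  assumes "recursive F" "recursive G"
  shows "recursive (\<lambda>g n. F g n div G g n)"
proof -
  have div: "a div b = (\<Sum>k<a. of_bool (0 < b \<and> Suc k * b \<le> a))" for a b :: nat
  proof (cases "b = 0")
    case False
    then have "0 < b \<and> Suc k * b \<le> a \<longleftrightarrow> k < a div b" for k
      by (simp only: less_eq_div_iff_mult_less_eq[symmetric] Suc_le_eq) simp
    then have "{..<a} \<inter> {k. 0 < b \<and> Suc k * b \<le> a} = {..<a div b}"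
      using div_le_dividend[of a b] by (auto intro: less_le_trans simp del: div_le_dividend)
    then show ?thesis by simp
  qed simp
  show ?thesis unfolding div
    by (intro recursive_sum recursive_of_bool decidable_conj decidable_less decidable_le
        recursive_mult recursive_basics recursive_compose[OF assms(1)] recursive_compose[OF assms(2)] assms)
qed

lemma recursive_mod:
  assumes "recursive F" "recursive G"
  shows "recursive (\<lambda>g n. F g n mod G g n)"
  unfolding modulo_nat_def by (intro recursive_diff recursive_mult recursive_div assms)

lemmas recursive_intros =
  recursive_basics recursive_add recursive_diff recursive_mult recursive_power recursive_div
  recursive_mod recursive_sum recursive_if recursive_of_bool recursive_rec_nat
  decidable_le decidable_less decidable_eq decidable_not decidable_conj decidable_disj
  decidable_imp decidable_ex decidable_all

section \<open>Codes of programs\<close>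

fun constant_program :: "nat \<Rightarrow> program" where
  "constant_program 0 = Zero"
| "constant_program (Suc n) = Compose Succ (constant_program n)"

lemma runs_constant_program: "runs A (constant_program c) n c"
  by (induction c) (auto intro: runs.Zero runs.Succ runs.Compose)

lemma recursive_code_constant_program: "recursive (\<lambda>g n. code (constant_program n))"
proof -
  have "code (constant_program n) =
      rec_nat (code Zero) (\<lambda>k r. prod_encode (6, prod_encode (code Succ, r))) n" for n
    by (induction n) auto
  then show ?thesis by (simp only:) (intro recursive_intros)
qed

text \<open>The recursion runs over the fixed template, never over the code \<open>c\<close>. For
  each template it therefore unfolds to finitely many pairings and is recursive in \<open>c\<close>
  without any decoding of programs.\<close>

primrec plug_code :: "nat \<Rightarrow> program \<Rightarrow> nat" where
  "plug_code c Zero = code Zero"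
| "plug_code c Succ = code Succ"
| "plug_code c First = code First"
| "plug_code c Second = code Second"
| "plug_code c Query = c"
| "plug_code c (Fork r s) = prod_encode (5, prod_encode (plug_code c r, plug_code c s))"
| "plug_code c (Compose r s) = prod_encode (6, prod_encode (plug_code c r, plug_code c s))"
| "plug_code c (PrimRec r s) = prod_encode (7, prod_encode (plug_code c r, plug_code c s))"
| "plug_code c (Minimize r) = prod_encode (8, plug_code c r)"

lemma plug_code: "plug_code (code p) R = code (plug p R)"
  by (induction R) auto

lemma recursive_plug_code: "recursive F \<Longrightarrow> recursive (\<lambda>g n. plug_code (F g n) R)"
  by (induction R) (auto intro!: recursive_intros)

lemma code_in_halting_problem:
  "prod_encode (code p, n) \<in> halting_problem \<longleftrightarrow> (\<exists>m. runs {} p n m)"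
  by (auto simp: halting_problem_def)

text \<open>Unbounded search for a zero of the negated test halts exactly when a witness exists. The
  template is chosen before \<open>p\<close>, so the halting question is computable from
  \<open>code p\<close>.\<close>

lemma ex_halting_test:
  assumes "decidable (\<lambda>g z. P g (pfst z) (psnd z))"
  obtains R where "\<And>p g y. (\<And>m. runs {} p m (g m)) \<Longrightarrow>
    prod_encode (plug_code (code p) R, y) \<in> halting_problem \<longleftrightarrow> (\<exists>w. P g y w)"
proof -
  from decidable_not[OF assms] obtain T where
    T: "realizes T (\<lambda>g z. of_bool (\<not> P g (pfst z) (psnd z)))"
    by (auto simp: decidable_def recursive_def)
  show thesis
  proof (rule that[of "Minimize T"])
    fix p g y assume p: "\<And>m. runs {} p m (g m)"
    have runsT: "runs {} (plug p T) (prod_encode (y, w)) (of_bool (\<not> P g y w))" for w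
      using realizesD[OF T p, of "prod_encode (y, w)"] by simp
    have "(\<exists>m. runs {} (Minimize (plug p T)) y m) \<longleftrightarrow> (\<exists>w. P g y w)"
    proof
      assume "\<exists>m. runs {} (Minimize (plug p T)) y m"
      then obtain m where "runs {} (Minimize (plug p T)) y m" by blast
      then have "runs {} (plug p T) (prod_encode (y, m)) 0" by (rule runs_elims(9))
      from runs_functional[OF this runsT] have "P g y m" by (simp split: if_splits)
      then show "\<exists>w. P g y w" ..
    next
      assume "\<exists>w. P g y w"
      \<comment> \<open>\<open>Minimize\<close> demands a nonzero value at every argument before the
        zero it returns, so an arbitrary witness would not do.\<close>
      define w where "w = (LEAST w. P g y w)"
      have "P g y w" unfolding w_def using \<open>\<exists>w. P g y w\<close> by (rule LeastI_ex)
      then have "runs {} (plug p T) (prod_encode (y, w)) 0" using runsT[of w] by simp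
      moreover have "runs {} (plug p T) (prod_encode (y, m)) (Suc 0)" if "m < w" for m
        using runsT[of m] not_less_Least[OF that[unfolded w_def]] by simp
      ultimately have "runs {} (Minimize (plug p T)) y w" by (rule runs.Minimize)
      then show "\<exists>m. runs {} (Minimize (plug p T)) y m" ..
    qed
    then show "prod_encode (plug_code (code p) (Minimize T), y) \<in> halting_problem \<longleftrightarrow> (\<exists>w. P g y w)"
      unfolding plug_code code_in_halting_problem by simp
  qed
qed

text \<open>
  The nested pair \<open>L n\<close> lists an increasing sequence, last entry first. Each new entry is found by an
  unbounded search, which only needs to succeed along the actual iteration.
\<close>

lemma ex_search_iteration:
  assumes "recursive F"
  obtains Q where "\<And>A p g a L d n. (\<And>m. runs A p m (g m)) \<Longrightarrow>
    L 0 = prod_encode (0, 0) \<Longrightarrow>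
    (\<And>n. L (Suc n) = prod_encode (pfst (L n) + Suc (d n), L n)) \<Longrightarrow>
    (\<And>n. F g (prod_encode (prod_encode (a, prod_encode (n, L n)), d n)) = 0) \<Longrightarrow>
    (\<And>n c. c < d n \<Longrightarrow> F g (prod_encode (prod_encode (a, prod_encode (n, L n)), c)) \<noteq> 0) \<Longrightarrow>
    runs A (plug p Q) (prod_encode (a, n)) (L n)"
proof -
  from assms obtain T where T: "realizes T F" by (auto simp: recursive_def)
  have "recursive (\<lambda>g z. prod_encode (pfst (psnd (psnd (pfst z))) + Suc (psnd z), psnd (psnd (pfst z))))"
    by (intro recursive_intros)
  then obtain U where
    U: "realizes U (\<lambda>g z. prod_encode (pfst (psnd (psnd (pfst z))) + Suc (psnd z), psnd (psnd (pfst z))))"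
    by (auto simp: recursive_def)
  have "recursive (\<lambda>g z. prod_encode (0, 0))" by (intro recursive_intros)
  then obtain Z where Z: "realizes Z (\<lambda>g z. prod_encode (0, 0))" by (auto simp: recursive_def)
  have "recursive (\<lambda>g n. n)" by (intro recursive_intros)
  then obtain I where I: "realizes I (\<lambda>g n. n)" by (auto simp: recursive_def)
  show thesis
  proof (rule that[of "PrimRec Z (Compose U (Fork I (Minimize T)))"])
    fix A p g a L d n
    assume p: "\<And>m. runs A p m (g m)" and L0: "L 0 = prod_encode (0, 0)"
      and L: "\<And>n. L (Suc n) = prod_encode (pfst (L n) + Suc (d n), L n)"
      and found: "\<And>n. F g (prod_encode (prod_encode (a, prod_encode (n, L n)), d n)) = 0"
      and least: "\<And>n c. c < d n \<Longrightarrow> F g (prod_encode (prod_encode (a, prod_encode (n, L n)), c)) \<noteq> 0"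
    show "runs A (plug p (PrimRec Z (Compose U (Fork I (Minimize T))))) (prod_encode (a, n)) (L n)"
    proof (induction n)
      case 0
      show ?case using realizesD[OF Z p] by (auto simp: L0 intro: runs.PrimRec_0)
    next
      case (Suc n)
      let ?y = "prod_encode (a, prod_encode (n, L n))"
      have "runs A (Minimize (plug p T)) ?y (d n)"
      proof (rule runs.Minimize)
        show "runs A (plug p T) (prod_encode (?y, d n)) 0"
          using realizesD[OF T p, of "prod_encode (?y, d n)"] found[of n] by simp
      next
        fix c assume "c < d n"
        from least[OF this] obtain v where v: "F g (prod_encode (?y, c)) = Suc v"
          using not0_implies_Suc by blast
        then have "F g (prod_encode (?y, c)) = Suc (F g (prod_encode (?y, c)) - 1)" by simp
        then show "runs A (plug p T) (prod_encode (?y, c)) (Suc (F g (prod_encode (?y, c)) - 1))"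
          using realizesD[OF T p, of "prod_encode (?y, c)"] by metis
      qed
      from runs.Fork[OF realizesD[OF I p] this]
      have "runs A (plug p (Compose U (Fork I (Minimize T)))) ?y (L (Suc n))"
        using realizesD[OF U p, of "prod_encode (?y, d n)"] by (auto simp: L intro: runs.Compose)
      with Suc.IH show ?case by (auto intro: runs.PrimRec_Suc)
    qed
  qed
qed

section \<open>Approximating integrals from below by counting grid cells\<close>

lemma SUP_finite_in:
  fixes a :: "'i \<Rightarrow> 'b :: complete_linorder"
  assumes "finite I" "I \<noteq> {}"
  shows "(SUP i\<in>I. a i) \<in> a ` I"
  using Max_in[of "a ` I"] assms by (simp add: Max_Sup)

lemma INF_finite_in:
  fixes a :: "'i \<Rightarrow> 'b :: complete_linorder"
  assumes "finite I" "I \<noteq> {}"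
  shows "(INF i\<in>I. a i) \<in> a ` I"
  using Min_in[of "a ` I"] assms by (simp add: Min_Inf)

lemma le_SUP_finite_iff:
  fixes a :: "'i \<Rightarrow> 'b :: complete_linorder"
  assumes "finite I" "y \<noteq> bot"
  shows "y \<le> (SUP i\<in>I. a i) \<longleftrightarrow> (\<exists>i\<in>I. y \<le> a i)"
proof
  assume y: "y \<le> (SUP i\<in>I. a i)"
  then have "I \<noteq> {}" using assms(2) by (auto simp: bot_unique)
  then show "\<exists>i\<in>I. y \<le> a i" using SUP_finite_in[OF assms(1), of a] y by auto
qed (auto intro: SUP_upper2)

abbreviation (input) height :: "nat \<Rightarrow> ennreal" where
  "height r \<equiv> ennreal (real_of_rat (pos_rat_of r))"

lemma real_pos_rat_of: "real_of_rat (pos_rat_of r) = real (Suc (pfst r)) / real (Suc (psnd r))"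
  by (simp add: pos_rat_of_def of_rat_divide of_rat_add split: prod.split)

lemma pos_rat_of_le_iff:
  "pos_rat_of r \<le> pos_rat_of s \<longleftrightarrow> Suc (pfst r) * Suc (psnd s) \<le> Suc (pfst s) * Suc (psnd r)"
proof -
  have "pos_rat_of r \<le> pos_rat_of s \<longleftrightarrow> real_of_rat (pos_rat_of r) \<le> real_of_rat (pos_rat_of s)"
    by (simp add: of_rat_less_eq)
  also have "\<dots> \<longleftrightarrow> real (Suc (pfst r)) * real (Suc (psnd s)) \<le> real (Suc (pfst s)) * real (Suc (psnd r))"
    unfolding real_pos_rat_of by (subst divide_le_eq) (simp_all add: pos_le_divide_eq mult.commute)
  also have "\<dots> \<longleftrightarrow> Suc (pfst r) * Suc (psnd s) \<le> Suc (pfst s) * Suc (psnd r)"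
    by (simp only: of_nat_mult[symmetric] of_nat_le_iff)
  finally show ?thesis .
qed

lemma height_le_iff: "height r \<le> height s \<longleftrightarrow> pos_rat_of r \<le> pos_rat_of s"
proof -
  have "0 \<le> real_of_rat (pos_rat_of s)" by (simp add: real_pos_rat_of)
  then show ?thesis by (simp add: ennreal_le_iff of_rat_less_eq)
qed

lemma ennreal_nat_divide_mono: "a \<le> b \<Longrightarrow> ennreal (real a / real c) \<le> ennreal (real b / real c)"
  by (intro ennreal_leI divide_right_mono) auto

lemma height_pos: "0 < height r"
  by (simp add: real_pos_rat_of)

lemma basic_fun_eq:
  "basic_fun B m x = (if m \<noteq> 0 \<and> x \<in> B (psnd (m - 1)) then height (pfst (m - 1)) else 0)"
  by (auto simp: basic_fun_def split: nat.split prod.split)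

section \<open>Block minima and their finite stages\<close>

definition entry :: "nat \<Rightarrow> nat \<Rightarrow> nat" where
  "entry L j = pfst (rec_nat L (\<lambda>_ r. psnd r) j)"

definition block :: "(nat \<Rightarrow> 'a \<Rightarrow> ennreal) \<Rightarrow> nat \<Rightarrow> nat \<Rightarrow> 'a \<Rightarrow> ennreal" where
  "block f a b x = (INF k\<in>{a..<b}. f k x)"

text \<open>This is the function whose integral the invariant bounds. \<open>L\<close> lists
  thresholds newest first, so the older endpoint of block \<open>j\<close> is the entry at
  \<open>Suc j\<close>.\<close>

definition upper :: "(nat \<Rightarrow> 'a \<Rightarrow> ennreal) \<Rightarrow> nat \<Rightarrow> nat \<Rightarrow> nat \<Rightarrow> 'a \<Rightarrow> ennreal" where
  "upper f n L i x = sup (SUP j\<in>{..<n}. block f (entry L (Suc j)) (entry L j) x) (f i x)"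

definition enumerated :: "(nat \<Rightarrow> 'a set) \<Rightarrow> (nat \<Rightarrow> nat) \<Rightarrow> nat \<Rightarrow> 'a \<Rightarrow> ennreal" where
  "enumerated B g k x = (SUP j. basic_fun B (g (prod_encode (k, j))) x)"

definition enumerated_upto :: "(nat \<Rightarrow> 'a set) \<Rightarrow> (nat \<Rightarrow> nat) \<Rightarrow> nat \<Rightarrow> nat \<Rightarrow> 'a \<Rightarrow> ennreal" where
  "enumerated_upto B g t k x = (SUP j\<in>{..<t}. basic_fun B (g (prod_encode (k, j))) x)"

lemma enumerated_upto_mono: "t \<le> t' \<Longrightarrow> enumerated_upto B g t k x \<le> enumerated_upto B g t' k x"
  unfolding enumerated_upto_def by (rule SUP_subset_mono) auto

lemma less_enumerated_upto:
  assumes "y < enumerated B g k x"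
  shows "\<exists>t. y < enumerated_upto B g t k x"
proof -
  from assms obtain j where j: "y < basic_fun B (g (prod_encode (k, j))) x"
    by (auto simp: enumerated_def less_SUP_iff)
  have "basic_fun B (g (prod_encode (k, j))) x \<le> enumerated_upto B g (Suc j) k x"
    unfolding enumerated_upto_def by (rule SUP_upper) auto
  with j show ?thesis by (auto intro: less_le_trans)
qed

text \<open>Each of the finitely many functions passes an intermediate value at its own stage, and
  the sum of these stages serves them all. The intermediate value keeps the inequality
  strict.\<close>

lemma less_block_upto:
  assumes "y < block (enumerated B g) a b x"
  shows "\<exists>t. y < block (enumerated_upto B g t) a b x"
proof -
  obtain z where z: "y < z" "z < block (enumerated B g) a b x" using dense[OF assms] by blast
  then have "\<forall>k\<in>{a..<b}. \<exists>t. z < enumerated_upto B g t k x"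
    using less_enumerated_upto by (metis block_def less_INF_D)
  then obtain T where T: "\<And>k. k \<in> {a..<b} \<Longrightarrow> z < enumerated_upto B g (T k) k x" by metis
  define t where "t = (\<Sum>k\<in>{a..<b}. T k)"
  have "z \<le> enumerated_upto B g t k x" if "k \<in> {a..<b}" for k
    using T[OF that] enumerated_upto_mono[of "T k" t B g k x] member_le_sum[of k "{a..<b}" T] that
    by (auto simp: t_def)
  then have "z \<le> block (enumerated_upto B g t) a b x" unfolding block_def by (auto intro: INF_greatest)
  with z(1) show ?thesis by (auto intro: less_le_trans)
qed

lemma upper_mono: "(\<And>k x. f k x \<le> f' k x) \<Longrightarrow> upper f n L i x \<le> upper f' n L i x"
  unfolding upper_def block_def by (intro sup_mono SUP_mono' INF_mono') auto

lemma upper_enumerated_le_SUP: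
  "upper (enumerated B g) n L i x \<le> (SUP t. upper (enumerated_upto B g t) n L i x)"
proof (rule dense_le)
  fix y assume "y < upper (enumerated B g) n L i x"
  then consider j where "j < n" "y < block (enumerated B g) (entry L (Suc j)) (entry L j) x"
    | "y < enumerated B g i x"
    by (auto simp: upper_def sup_max less_max_iff_disj less_SUP_iff)
  then obtain t where "y < upper (enumerated_upto B g t) n L i x"
  proof cases
    case 1
    with less_block_upto[OF 1(2)] show thesis
      using that by (fastforce simp: upper_def sup_max less_max_iff_disj less_SUP_iff)
  next
    case 2
    with less_enumerated_upto[OF 2] show thesis by (auto simp: upper_def sup_max less_max_iff_disj intro: that)
  qed
  then show "y \<le> (SUP t. upper (enumerated_upto B g t) n L i x)"
    by (intro SUP_upper2[of t]) auto
qed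

text \<open>The product of all denominators turns every height into a multiple of 1 / (d + 1), and
  \<open>H\<close> bounds the multiples. Finite nonempty maxima and minima do not leave this set of
  values.\<close>

lemma common_denominator:
  assumes "finite C"
  shows "\<exists>d H. \<forall>m\<in>C. \<forall>x. basic_fun B m x \<in> (\<lambda>N. ennreal (real N / real (Suc d))) ` {..H}"
proof -
  define b where "b m = Suc (psnd (pfst (m - 1)))" for m
  define D where "D = (\<Prod>m\<in>C. b m)"
  define H where "H = (\<Sum>m\<in>C. Suc (pfst (pfst (m - 1))) * D)"
  have D: "D > 0" unfolding D_def b_def by (rule prod_pos) simp
  have "basic_fun B m x \<in> (\<lambda>N. ennreal (real N / real D)) ` {..H}" if m: "m \<in> C" for m x
  proof -
    define N where "N = Suc (pfst (pfst (m - 1))) * (D div b m)"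
    have "b m dvd D" using m assms unfolding D_def by (rule dvd_prodI[rotated])
    then have D': "real D = real (b m) * real (D div b m)"
      by (metis dvd_mult_div_cancel of_nat_mult)
    with D have "real (D div b m) \<noteq> 0" by (metis mult_zero_right of_nat_0_eq_iff less_irrefl)
    then have "height (pfst (m - 1)) = ennreal (real N / real D)"
      unfolding real_pos_rat_of N_def D' b_def[symmetric] of_nat_mult by simp
    moreover have "N \<le> Suc (pfst (pfst (m - 1))) * D" unfolding N_def by (intro mult_le_mono) auto
    then have "N \<le> H" using member_le_sum[of m C "\<lambda>m. Suc (pfst (pfst (m - 1))) * D"] m assms
      unfolding H_def by simp
    ultimately show ?thesis by (auto simp: basic_fun_eq intro: image_eqI[of _ _ 0])
  qed
  with D show ?thesis by (intro exI[of _ "D - 1"] exI[of _ H]) auto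
qed

lemma block_measurable [measurable]:
  assumes [measurable]: "\<And>k. f k \<in> borel_measurable M"
  shows "block f a b \<in> borel_measurable M"
  unfolding block_def[abs_def] by (intro borel_measurable_INF) auto

lemma upper_measurable [measurable]:
  assumes [measurable]: "\<And>k. f k \<in> borel_measurable M"
  shows "upper f n L i \<in> borel_measurable M"
  unfolding upper_def[abs_def] by (intro borel_measurable_sup borel_measurable_SUP) auto

text \<open>\<open>sub\<close> is a decidable sufficient condition for inclusion, and
  \<open>sub_base\<close> covers intersections of basic sets by basic sets. Cells of one resolution
  are disjoint and of equal measure, so integrals of step functions reduce to counting.
  \<open>cells_exhaust\<close> holds only almost everywhere because open cells on the line miss the
  grid points.\<close>

locale effective_measure_space =
  fixes M :: "'a measure" and B :: "nat \<Rightarrow> 'a set" and sub :: "nat \<Rightarrow> nat \<Rightarrow> bool"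
    and cell :: "nat \<Rightarrow> nat \<Rightarrow> nat" and cells weight :: "nat \<Rightarrow> nat"
  assumes sets_B: "B u \<in> sets M"
    and sub_subset: "sub u v \<Longrightarrow> B u \<subseteq> B v"
    and sub_trans: "sub u v \<Longrightarrow> sub v w \<Longrightarrow> sub u w"
    and sub_base: "x \<in> B v \<Longrightarrow> x \<in> B w \<Longrightarrow> \<exists>u. x \<in> B u \<and> sub u v \<and> sub u w"
    and cell_disjoint: "m < cells S \<Longrightarrow> m' < cells S \<Longrightarrow> m \<noteq> m' \<Longrightarrow> B (cell S m) \<inter> B (cell S m') = {}"
    and weight_pos: "0 < weight S"
    and emeasure_cell: "m < cells S \<Longrightarrow> emeasure M (B (cell S m)) = ennreal (1 / real (weight S))"
    and cells_exhaust: "finite F \<Longrightarrow>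
      \<exists>S. AE x in M. \<forall>v\<in>F. x \<in> B v \<longrightarrow> (\<exists>m<cells S. x \<in> B (cell S m) \<and> sub (cell S m) v)"
    and decidable_sub: "decidable (\<lambda>g z. sub (pfst z) (psnd z))"
    and recursive_cell: "recursive (\<lambda>g z. cell (pfst z) (psnd z))"
    and recursive_cells: "recursive (\<lambda>g. cells)"
    and recursive_weight: "recursive (\<lambda>g. weight)"
begin

section \<open>Certified lower bounds and the counting of cells\<close>

definition inside :: "nat \<Rightarrow> nat \<Rightarrow> bool" where
  "inside z m \<longleftrightarrow>
     m \<noteq> 0 \<and> pos_rat_of (pfst z) \<le> pos_rat_of (pfst (m - 1)) \<and> sub (psnd z) (psnd (m - 1))"

definition below :: "(nat \<Rightarrow> nat) \<Rightarrow> nat \<Rightarrow> nat \<Rightarrow> nat \<Rightarrow> bool" where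
  "below g t k z \<longleftrightarrow> (\<exists>j<t. inside z (g (prod_encode (k, j))))"

definition below_block :: "(nat \<Rightarrow> nat) \<Rightarrow> nat \<Rightarrow> nat \<Rightarrow> nat \<Rightarrow> nat \<Rightarrow> bool" where
  "below_block g t a b z \<longleftrightarrow> (\<forall>k<b. a \<le> k \<longrightarrow> below g t k z)"

definition below_upper :: "(nat \<Rightarrow> nat) \<Rightarrow> nat \<Rightarrow> nat \<Rightarrow> nat \<Rightarrow> nat \<Rightarrow> nat \<Rightarrow> bool" where
  "below_upper g t n L i z \<longleftrightarrow>
     (\<exists>j<n. below_block g t (entry L (Suc j)) (entry L j) z) \<or> below g t i z"

text \<open>The code (l, d) stands for the height (l + 1) / (d + 1). Counting certified heights
  instead of taking the largest one keeps this a bounded sum of decidable terms.\<close>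

definition cell_count :: "(nat \<Rightarrow> nat) \<Rightarrow> nat \<Rightarrow> nat \<Rightarrow> nat \<Rightarrow> nat \<Rightarrow> nat \<Rightarrow> nat \<Rightarrow> nat \<Rightarrow> nat \<Rightarrow> nat" where
  "cell_count g t n L i S d H m =
     (\<Sum>l<H. of_bool (below_upper g t n L i (prod_encode (prod_encode (l, d), cell S m))))"

lemma inside_le_basic_fun:
  assumes "inside z m" "x \<in> B (psnd z)"
  shows "height (pfst z) \<le> basic_fun B m x"
  using assms sub_subset by (auto simp: inside_def basic_fun_eq height_le_iff)

lemma below_le:
  assumes "below g t k z" "x \<in> B (psnd z)"
  shows "height (pfst z) \<le> enumerated B g k x"
  using assms inside_le_basic_fun unfolding below_def enumerated_def by (auto intro: SUP_upper2)

lemma below_block_le: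
  assumes "below_block g t a b z" "x \<in> B (psnd z)"
  shows "height (pfst z) \<le> block (enumerated B g) a b x"
  using assms below_le unfolding below_block_def block_def by (intro INF_greatest) auto

lemma below_upper_le:
  assumes "below_upper g t n L i z" "x \<in> B (psnd z)"
  shows "height (pfst z) \<le> upper (enumerated B g) n L i x"
  using assms(1) unfolding below_upper_def
proof (elim disjE exE conjE)
  fix j assume "j < n" "below_block g t (entry L (Suc j)) (entry L j) z"
  with below_block_le[OF this(2) assms(2)] show ?thesis
    unfolding upper_def by (intro le_supI1 SUP_upper2[of j]) auto
next
  assume "below g t i z"
  with below_le[OF this assms(2)] show ?thesis unfolding upper_def by (rule_tac le_supI2)
qed

lemma sum_cells:
  fixes h :: "nat \<Rightarrow> ennreal"
  assumes "m < cells S" "x \<in> B (cell S m)"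
  shows "(\<Sum>m<cells S. h m * indicator (B (cell S m)) x) = h m"
proof -
  have "(\<Sum>m'<cells S. h m' * indicator (B (cell S m')) x) = (\<Sum>m'<cells S. if m = m' then h m' else 0)"
    using assms cell_disjoint[OF assms(1)] by (intro sum.cong) (auto split: split_indicator)
  with assms(1) show ?thesis by simp
qed

lemma lower_sum_le:
  "(\<Sum>m<cells S. ennreal (real (cell_count g t n L i S d H m) / real (Suc d)) * indicator (B (cell S m)) x)
    \<le> upper (enumerated B g) n L i x" (is "?s \<le> ?u")
proof (cases "\<exists>m<cells S. x \<in> B (cell S m)")
  case True
  then obtain m where m: "m < cells S" "x \<in> B (cell S m)" by blast
  define X where "X = {l. l < H \<and> below_upper g t n L i (prod_encode (prod_encode (l, d), cell S m))}"
  have X: "finite X" "cell_count g t n L i S d H m = card X"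
    by (auto simp: X_def cell_count_def intro!: arg_cong[of _ _ card])
  have "ennreal (real (card X) / real (Suc d)) \<le> ?u"
  proof (cases "X = {}")
    case False
    define l where "l = Max X"
    have l: "l \<in> X" "X \<subseteq> {..l}" using X(1) False by (auto simp: l_def)
    \<comment> \<open>All counted indices are at most \<open>l\<close>, so the count cannot exceed l
      + 1, the numerator of a height that is certified. Hence no choice of stage or grid
      overestimates.\<close>
    have "card X \<le> Suc l" using card_mono[OF _ l(2)] by simp
    then have "ennreal (real (card X) / real (Suc d)) \<le> height (prod_encode (l, d))"
      using ennreal_nat_divide_mono[of "card X" "Suc l" "Suc d"] by (simp add: real_pos_rat_of)
    also have "\<dots> \<le> ?u" using below_upper_le[of g t n L i "prod_encode (prod_encode (l, d), cell S m)" x]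
      l(1) m(2) by (simp add: X_def)
    finally show ?thesis .
  qed simp
  then show ?thesis by (simp add: sum_cells[OF m] X(2))
next
  case False
  then have "?s = 0" by (auto intro!: sum.neutral)
  then show ?thesis by simp
qed

text \<open>A finite stage involves finitely many basic functions, so one denominator and one grid
  resolve it: at almost every point a value N / (d + 1) produces N certified heights. An empty block
  would have infimum \<infinity>, which is no multiple of 1 / (d + 1).\<close>

lemma ex_upper_le_lower_sum:
  assumes nonempty: "\<And>j. j < n \<Longrightarrow> entry L (Suc j) < entry L j"
  shows "\<exists>S d H. AE x in M. upper (enumerated_upto B g t) n L i x \<le>
    (\<Sum>m<cells S. ennreal (real (cell_count g t n L i S d H m) / real (Suc d)) * indicator (B (cell S m)) x)"
proof -
  define K where "K = insert i (\<Union>j<n. {..<entry L j})"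
  define C where "C = (\<lambda>(k, j). g (prod_encode (k, j))) ` (K \<times> {..<t})"
  have "finite C" by (auto simp: C_def K_def)
  from common_denominator[OF this, of B] obtain d H where
    dH: "\<And>m x. m \<in> C \<Longrightarrow> basic_fun B m x \<in> (\<lambda>N. ennreal (real N / real (Suc d))) ` {..H}" by blast
  from cells_exhaust[of "(\<lambda>m. psnd (m - 1)) ` C"] \<open>finite C\<close> obtain S where
    S: "AE x in M. \<forall>m\<in>C. x \<in> B (psnd (m - 1)) \<longrightarrow>
      (\<exists>c<cells S. x \<in> B (cell S c) \<and> sub (cell S c) (psnd (m - 1)))" by auto
  define q where "q N = ennreal (real N / real (Suc d))" for N
  have q0: "0 \<in> q ` {..H}" by (auto simp: q_def intro!: image_eqI[of _ _ 0])
  have upto: "enumerated_upto B g t k x \<in> q ` {..H}" if "k \<in> K" for k x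
  proof (cases "t = 0")
    case True
    then show ?thesis using q0 by (simp add: enumerated_upto_def bot_ennreal)
  next
    case False
    then have "enumerated_upto B g t k x \<in> (\<lambda>j. basic_fun B (g (prod_encode (k, j))) x) ` {..<t}"
      unfolding enumerated_upto_def by (intro SUP_finite_in) auto
    then show ?thesis using dH that by (auto simp: C_def q_def[abs_def])
  qed
  have block: "block (enumerated_upto B g t) (entry L (Suc j)) (entry L j) x \<in> q ` {..H}" if "j < n" for j x
  proof -
    have "block (enumerated_upto B g t) (entry L (Suc j)) (entry L j) x \<in>
      (\<lambda>k. enumerated_upto B g t k x) ` {entry L (Suc j)..<entry L j}"
      unfolding block_def using nonempty[OF that] by (intro INF_finite_in) auto
    then obtain k where k: "k < entry L j"
      "block (enumerated_upto B g t) (entry L (Suc j)) (entry L j) x = enumerated_upto B g t k x"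
      by auto
    with that have "k \<in> K" by (auto simp: K_def)
    then show ?thesis unfolding k(2) by (rule upto)
  qed
  have upper: "upper (enumerated_upto B g t) n L i x \<in> q ` {..H}" for x
  proof -
    have "(SUP j\<in>{..<n}. block (enumerated_upto B g t) (entry L (Suc j)) (entry L j) x) \<in> q ` {..H}"
    proof (cases "n = 0")
      case True
      then show ?thesis using q0 by (simp add: bot_ennreal)
    next
      case False
      then have "(SUP j\<in>{..<n}. block (enumerated_upto B g t) (entry L (Suc j)) (entry L j) x) \<in>
        (\<lambda>j. block (enumerated_upto B g t) (entry L (Suc j)) (entry L j) x) ` {..<n}"
        by (intro SUP_finite_in) auto
      then show ?thesis using block by auto
    qed
    moreover have "enumerated_upto B g t i x \<in> q ` {..H}" by (rule upto) (simp add: K_def)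
    ultimately show ?thesis unfolding upper_def by (simp add: sup_max max_def)
  qed
  have "upper (enumerated_upto B g t) n L i x \<le>
    (\<Sum>m<cells S. ennreal (real (cell_count g t n L i S d H m) / real (Suc d)) * indicator (B (cell S m)) x)"
    (is "?u \<le> ?s")
    if x: "\<forall>m\<in>C. x \<in> B (psnd (m - 1)) \<longrightarrow>
      (\<exists>c<cells S. x \<in> B (cell S c) \<and> sub (cell S c) (psnd (m - 1)))" for x
  proof -
    obtain N where N: "?u = q N" "N \<le> H" using upper[of x] by auto
    show ?thesis
    proof (cases "\<exists>c<cells S. x \<in> B (cell S c)")
      case True
      then obtain c where c: "c < cells S" "x \<in> B (cell S c)" by blast
      \<comment> \<open>By the choice of \<open>S\<close>, every basic set involved that contains x
        formally contains a cell through x. Disjointness makes this the same cell \<open>c\<close>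
        each time, so bounds at the point x become certificates on \<open>c\<close>.\<close>
      have below: "below g t k (prod_encode (r, cell S c))"
        if k: "k \<in> K" and r: "height r \<le> enumerated_upto B g t k x" for r k
      proof -
        from r obtain j where j: "j < t" "height r \<le> basic_fun B (g (prod_encode (k, j))) x"
          unfolding enumerated_upto_def
          by (subst (asm) le_SUP_finite_iff) (use height_pos[of r] in \<open>auto simp: bot_ennreal\<close>)
        let ?m = "g (prod_encode (k, j))"
        have m: "?m \<noteq> 0" "x \<in> B (psnd (?m - 1))" "height r \<le> height (pfst (?m - 1))"
          using j(2) height_pos[of r] by (auto simp: basic_fun_eq split: if_splits)
        have "?m \<in> C" using k j(1) by (auto simp: C_def)
        with x m(2) obtain c' where c': "c' < cells S" "x \<in> B (cell S c')" "sub (cell S c') (psnd (?m - 1))"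
          by blast
        then have "c' = c" using cell_disjoint[OF c(1) c'(1)] c(2) by auto
        then show ?thesis using c' m j by (auto simp: below_def inside_def height_le_iff)
      qed
      have "below_upper g t n L i (prod_encode (prod_encode (l, d), cell S c))" if "l < N" for l
      proof -
        let ?r = "prod_encode (l, d)"
        have "height ?r \<le> q N" unfolding q_def real_pos_rat_of
          using that ennreal_nat_divide_mono[of "Suc l" N "Suc d"] by simp
        then have "height ?r \<le> ?u" by (simp add: N)
        then consider "height ?r \<le> (SUP j\<in>{..<n}. block (enumerated_upto B g t) (entry L (Suc j)) (entry L j) x)"
          | "height ?r \<le> enumerated_upto B g t i x"
          unfolding upper_def by (auto simp: sup_max max_def split: if_splits)
        then show ?thesis
        proof cases
          case 1
          then obtain j where j: "j < n"
            "height ?r \<le> block (enumerated_upto B g t) (entry L (Suc j)) (entry L j) x"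
            by (subst (asm) le_SUP_finite_iff) (use height_pos[of ?r] in \<open>auto simp: bot_ennreal\<close>)
          then have "below_block g t (entry L (Suc j)) (entry L j) (prod_encode (?r, cell S c))"
            unfolding below_block_def block_def by (auto simp: le_INF_iff K_def intro!: below)
          with j(1) show ?thesis by (auto simp: below_upper_def)
        next
          case 2
          then show ?thesis using below[of i] by (auto simp: below_upper_def K_def)
        qed
      qed
      then have "(\<Sum>l<N. 1) \<le> (\<Sum>l<N. of_bool (below_upper g t n L i (prod_encode (prod_encode (l, d), cell S c))) :: nat)"
        by (intro sum_mono) auto
      also have "\<dots> \<le> cell_count g t n L i S d H c" unfolding cell_count_def
        using N(2) by (intro sum_mono2) auto
      finally have "N \<le> cell_count g t n L i S d H c" by simp
      then have "q N \<le> q (cell_count g t n L i S d H c)"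
        unfolding q_def by (rule ennreal_nat_divide_mono)
      then show ?thesis unfolding N(1) sum_cells[OF c] by (simp add: q_def)
    next
      case False
      \<comment> \<open>By the choice of \<open>S\<close>, a point outside all cells is in none of
        the basic sets involved, so the whole finite stage vanishes there.\<close>
      then have out: "x \<notin> B (psnd (m - 1))" if "m \<in> C" for m using x that by blast
      then have zero: "enumerated_upto B g t k x = 0" if "k \<in> K" for k
        using that by (auto simp: enumerated_upto_def C_def basic_fun_eq bot_ennreal[symmetric] intro!: SUP_eqI)
      have "block (enumerated_upto B g t) (entry L (Suc j)) (entry L j) x \<le> 0" if "j < n" for j
      proof -
        have "entry L (Suc j) \<in> K" using nonempty[OF that] that by (auto simp: K_def)
        then show ?thesis unfolding block_def using nonempty[OF that]
          by (intro INF_lower2[of "entry L (Suc j)"]) (auto simp: zero)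
      qed
      then have "?u \<le> 0" unfolding upper_def by (intro le_supI SUP_least) (auto simp: zero K_def)
      then show ?thesis by simp
    qed
  qed
  with S show ?thesis by (intro exI[of _ S] exI[of _ d] exI[of _ H]) (auto elim: eventually_mono)
qed

lemma basic_fun_measurable: "basic_fun B m \<in> borel_measurable M"
  using sets_B by (cases "m = 0") (simp_all add: basic_fun_eq[abs_def])

lemma enumerated_measurable [measurable]: "enumerated B g k \<in> borel_measurable M"
  unfolding enumerated_def[abs_def] using basic_fun_measurable
  by (intro borel_measurable_SUP) auto

lemma enumerated_upto_measurable [measurable]: "enumerated_upto B g t k \<in> borel_measurable M"
  unfolding enumerated_upto_def[abs_def] using basic_fun_measurable
  by (intro borel_measurable_SUP) auto

lemma integral_lower_sum:
  "(\<integral>\<^sup>+x. (\<Sum>m<cells S. ennreal (real (h m) / real (Suc d)) * indicator (B (cell S m)) x) \<partial>M) =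
    ennreal (real (\<Sum>m<cells S. h m) / real (Suc d * weight S))"
proof -
  have "(\<integral>\<^sup>+x. (\<Sum>m<cells S. ennreal (real (h m) / real (Suc d)) * indicator (B (cell S m)) x) \<partial>M) =
      (\<Sum>m<cells S. ennreal (real (h m) / real (Suc d)) * emeasure M (B (cell S m)))"
    using sets_B by (subst nn_integral_sum) (auto simp: nn_integral_cmult_indicator)
  also have "\<dots> = (\<Sum>m<cells S. ennreal (real (h m) / real (Suc d * weight S)))"
    by (intro sum.cong) (auto simp: emeasure_cell ennreal_mult'[symmetric] algebra_simps)
  also have "\<dots> = ennreal (\<Sum>m<cells S. real (h m) / real (Suc d * weight S))"
    by (intro sum_ennreal) auto
  finally show ?thesis by (simp add: sum_divide_distrib)
qed

text \<open>Cell sums never exceed the integral. Conversely, monotone convergence lifts the integral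
  of some finite stage above the strict bound, and a suitable grid loses nothing of that stage.
  Cross multiplication leaves a comparison of naturals.\<close>

lemma lower_sum_test:
  assumes nonempty: "\<And>j. j < n \<Longrightarrow> entry L (Suc j) < entry L j" and cd: "0 < cd"
  shows "(\<exists>t S d H. cn * (Suc d * weight S) < (\<Sum>m<cells S. cell_count g t n L i S d H m) * cd) \<longleftrightarrow>
    ennreal (real cn / real cd) < (\<integral>\<^sup>+x. upper (enumerated B g) n L i x \<partial>M)" (is "?l \<longleftrightarrow> ?r")
proof -
  define I where "I t S d H = (\<integral>\<^sup>+x. (\<Sum>m<cells S.
    ennreal (real (cell_count g t n L i S d H m) / real (Suc d)) * indicator (B (cell S m)) x) \<partial>M)" for t S d H
  have frac: "a / b < c / d \<longleftrightarrow> a * d < c * b" if "0 < b" "0 < d" for a b c d :: real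
    using that by (simp add: field_simps)
  have test: "cn * (Suc d * weight S) < (\<Sum>m<cells S. cell_count g t n L i S d H m) * cd \<longleftrightarrow>
    ennreal (real cn / real cd) < I t S d H" for t S d H
  proof -
    have "ennreal (real cn / real cd) < I t S d H \<longleftrightarrow>
      real cn / real cd < real (\<Sum>m<cells S. cell_count g t n L i S d H m) / real (Suc d * weight S)"
      unfolding I_def integral_lower_sum by (subst ennreal_less_iff) auto
    also have "\<dots> \<longleftrightarrow> real cn * real (Suc d * weight S) <
        real (\<Sum>m<cells S. cell_count g t n L i S d H m) * real cd"
      using cd weight_pos[of S] by (subst frac) (auto simp del: of_nat_mult mult_Suc)
    also have "\<dots> \<longleftrightarrow> cn * (Suc d * weight S) < (\<Sum>m<cells S. cell_count g t n L i S d H m) * cd"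
      by (simp only: of_nat_mult[symmetric] of_nat_less_iff)
    finally show ?thesis by simp
  qed
  show ?thesis unfolding test
  proof
    assume "\<exists>t S d H. ennreal (real cn / real cd) < I t S d H"
    then obtain t S d H where "ennreal (real cn / real cd) < I t S d H" by blast
    also have "I t S d H \<le> (\<integral>\<^sup>+x. upper (enumerated B g) n L i x \<partial>M)"
      unfolding I_def by (intro nn_integral_mono lower_sum_le)
    finally show ?r .
  next
    assume ?r
    also have "(\<integral>\<^sup>+x. upper (enumerated B g) n L i x \<partial>M) \<le>
        (\<integral>\<^sup>+x. (SUP t. upper (enumerated_upto B g t) n L i x) \<partial>M)"
      by (intro nn_integral_mono upper_enumerated_le_SUP)
    also have "\<dots> = (SUP t. \<integral>\<^sup>+x. upper (enumerated_upto B g t) n L i x \<partial>M)"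
      by (intro nn_integral_monotone_convergence_SUP)
        (auto simp: incseq_def le_fun_def intro!: upper_mono enumerated_upto_mono)
    finally obtain t where
      "ennreal (real cn / real cd) < (\<integral>\<^sup>+x. upper (enumerated_upto B g t) n L i x \<partial>M)"
      by (auto simp: less_SUP_iff)
    also obtain S d H where "(\<integral>\<^sup>+x. upper (enumerated_upto B g t) n L i x \<partial>M) \<le> I t S d H"
      using ex_upper_le_lower_sum[OF nonempty, where t = t and i = i and g = g] unfolding I_def
      by (blast intro: nn_integral_mono_AE)
    finally show "\<exists>t S d H. ennreal (real cn / real cd) < I t S d H" by blast
  qed
qed

text \<open>The index \<open>i\<close> is part of the witness \<open>w\<close>, so a violation by
  any tail function is one existential question about \<open>y\<close>.\<close>

definition exceeds :: "(nat \<Rightarrow> nat) \<Rightarrow> nat \<Rightarrow> nat \<Rightarrow> bool" where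
  "exceeds g y w \<longleftrightarrow>
    (let n = pfst (psnd y); L = psnd (psnd y); i = pfst w; t = pfst (psnd w); S = pfst (psnd (psnd w));
         d = pfst (psnd (psnd (psnd w))); H = psnd (psnd (psnd (psnd w)))
     in entry L 0 \<le> i \<and> pfst (pfst y) * (Suc d * weight S) <
          (\<Sum>m<cells S. cell_count g t n L i S d H m) * psnd (pfst y))"

lemma ex_exceeds_iff:
  assumes "\<And>j. j < n \<Longrightarrow> entry L (Suc j) < entry L j" "0 < cd"
  shows "(\<exists>w. exceeds g (prod_encode (prod_encode (cn, cd), prod_encode (n, L))) w) \<longleftrightarrow>
    (\<exists>i\<ge>entry L 0. ennreal (real cn / real cd) < (\<integral>\<^sup>+x. upper (enumerated B g) n L i x \<partial>M))"
    (is "?l \<longleftrightarrow> ?r")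
proof
  assume ?l
  then show ?r unfolding exceeds_def Let_def
    by (simp add: lower_sum_test[OF assms, symmetric] del: mult_Suc) blast
next
  assume ?r
  then obtain i t S d H where "entry L 0 \<le> i"
    "cn * (Suc d * weight S) < (\<Sum>m<cells S. cell_count g t n L i S d H m) * cd"
    by (auto simp: lower_sum_test[OF assms, symmetric] simp del: mult_Suc)
  then have "exceeds g (prod_encode (prod_encode (cn, cd), prod_encode (n, L)))
    (prod_encode (i, prod_encode (t, prod_encode (S, prod_encode (d, H)))))"
    by (simp add: exceeds_def Let_def del: mult_Suc)
  then show ?l ..
qed

lemmas recursive_space_intros =
  recursive_intros recursive_compose[OF recursive_cells] recursive_compose[OF recursive_weight]
  recursive_compose2[where H = "\<lambda>g. cell", OF recursive_cell]
  decidable_compose2[where P = "\<lambda>g. sub", OF decidable_sub]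

lemma decidable_exceeds: "decidable (\<lambda>g z. exceeds g (pfst z) (psnd z))"
  unfolding exceeds_def Let_def cell_count_def below_upper_def below_block_def below_def inside_def
    pos_rat_of_le_iff entry_def
  by (intro recursive_space_intros)

definition block_contains :: "(nat \<Rightarrow> nat) \<Rightarrow> nat \<Rightarrow> nat \<Rightarrow> bool" where
  "block_contains g y t \<longleftrightarrow> below_block g t (pfst (pfst y)) (psnd (pfst y)) (psnd y)"

lemma decidable_block_contains: "decidable (\<lambda>g z. block_contains g (pfst z) (psnd z))"
  unfolding block_contains_def below_block_def below_def inside_def pos_rat_of_le_iff
  by (intro recursive_space_intros)

lemma ex_common_basic:
  assumes "finite I" "I \<noteq> {}" "\<And>k. k \<in> I \<Longrightarrow> x \<in> B (v k)"
  shows "\<exists>u. x \<in> B u \<and> (\<forall>k\<in>I. sub u (v k))"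
  using assms
proof (induction I rule: finite_ne_induct)
  case (singleton k)
  then show ?case using sub_base[of x "v k" "v k"] by auto
next
  case (insert k I)
  then obtain u where u: "x \<in> B u" "\<forall>k\<in>I. sub u (v k)" by auto
  with insert.prems[of k] sub_base[of x u "v k"] obtain w where
    "x \<in> B w" "sub w u" "sub w (v k)" by auto
  with u show ?case using sub_trans by blast
qed

text \<open>This is the completeness of enumerating a block minimum by certificates. At a common
  stage every function of the block has a basic function above y at x; the least of their heights,
  on a common basic neighbourhood of x, lies under all of them.\<close>

lemma ex_below_block:
  assumes "y < block (enumerated B g) a b x" "a < b"
  shows "\<exists>t z. below_block g t a b z \<and> x \<in> B (psnd z) \<and> y < height (pfst z)"
proof -
  from less_block_upto[OF assms(1)] obtain t where t: "y < block (enumerated_upto B g t) a b x" ..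
  have "\<exists>j<t. y < basic_fun B (g (prod_encode (k, j))) x" if "k \<in> {a..<b}" for k
    using less_INF_D[OF t[unfolded block_def] that] by (auto simp: enumerated_upto_def less_SUP_iff)
  then obtain J where J: "\<And>k. k \<in> {a..<b} \<Longrightarrow> J k < t"
    "\<And>k. k \<in> {a..<b} \<Longrightarrow> y < basic_fun B (g (prod_encode (k, J k))) x" by metis
  define m where "m k = g (prod_encode (k, J k))" for k
  have m: "m k \<noteq> 0" "x \<in> B (psnd (m k - 1))" "y < height (pfst (m k - 1))" if "k \<in> {a..<b}" for k
    using J(2)[OF that] by (auto simp: basic_fun_eq m_def split: if_splits)
  obtain u where u: "x \<in> B u" "\<And>k. k \<in> {a..<b} \<Longrightarrow> sub u (psnd (m k - 1))"
    using ex_common_basic[of "{a..<b}" x "\<lambda>k. psnd (m k - 1)"] m(2) assms(2) by auto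
  obtain l where l: "l \<in> {a..<b}" "\<And>k. k \<in> {a..<b} \<Longrightarrow> pos_rat_of (pfst (m l - 1)) \<le> pos_rat_of (pfst (m k - 1))"
    using ex_is_arg_min_if_finite[of "{a..<b}" "\<lambda>k. pos_rat_of (pfst (m k - 1))"] assms(2)
    by (force simp: is_arg_min_linorder)
  let ?z = "prod_encode (pfst (m l - 1), u)"
  have "below_block g t a b ?z" using J(1) m(1) u(2) l(2)
    by (auto simp: below_block_def below_def inside_def m_def[symmetric] intro!: exI[of _ "J _"])
  with u(1) m(3)[OF l(1)] show ?thesis by (intro exI[of _ t] exI[of _ ?z]) auto
qed

end

text \<open>\<open>V\<close> stands for the maximum of the older blocks. The integrals of the minima
  over [K, k) decrease in k, and k is taken where they are within c' - c of their infimum. Since the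
  minimum extended through i lies under \<open>f i\<close>, inserting the block [K, k) costs at most
  the difference of two such minima.\<close>

lemma ex_threshold:
  fixes f :: "nat \<Rightarrow> 'a \<Rightarrow> ennreal"
  assumes [measurable]: "\<And>k. f k \<in> borel_measurable M" "V \<in> borel_measurable M"
    and fin: "(\<integral>\<^sup>+x. f K x \<partial>M) < \<infinity>" and c: "0 \<le> c" "c < c'"
    and V: "\<And>i. K \<le> i \<Longrightarrow> (\<integral>\<^sup>+x. sup (V x) (f i x) \<partial>M) \<le> ennreal c"
  shows "\<exists>k>K. \<forall>i\<ge>k. (\<integral>\<^sup>+x. sup (sup (block f K k x) (V x)) (f i x) \<partial>M) \<le> ennreal c'"
proof -
  define a where "a k = (\<integral>\<^sup>+x. block f K k x \<partial>M)" for k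
  define I where "I = (INF k\<in>{K<..}. a k)"
  have fin_a: "a k < \<infinity>" if "K < k" for k
  proof -
    have "a k \<le> (\<integral>\<^sup>+x. f K x \<partial>M)" unfolding a_def block_def
      using that by (intro nn_integral_mono INF_lower) auto
    with fin show ?thesis by (rule le_less_trans[rotated])
  qed
  have "I \<le> a (Suc K)" unfolding I_def by (rule INF_lower) auto
  with fin_a[of "Suc K"] have "I < \<infinity>" by (auto intro: le_less_trans)
  then have "I < I + ennreal (c' - c)" using c by (cases I) (auto simp: ennreal_plus[symmetric] ennreal_less_iff simp del: ennreal_plus)
  then obtain k where k: "K < k" "a k < I + ennreal (c' - c)" by (auto simp: I_def INF_less_iff)
  have "(\<integral>\<^sup>+x. sup (sup (block f K k x) (V x)) (f i x) \<partial>M) \<le> ennreal c'" if i: "k \<le> i" for i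
  proof -
    \<comment> \<open>Blocks are half-open, so the end \<open>Suc i\<close> is what includes the
      index i and makes this block a minorant of \<open>f i\<close>.\<close>
    have le: "block f K (Suc i) x \<le> block f K k x" for x
      unfolding block_def using i by (intro INF_superset_mono) auto
    have "sup (sup (block f K k x) (V x)) (f i x) \<le> sup (V x) (f i x) + (block f K k x - block f K (Suc i) x)" for x
    proof (cases "block f K k x \<le> sup (V x) (f i x)")
      case True
      then have "sup (sup (block f K k x) (V x)) (f i x) = sup (V x) (f i x)"
        by (simp add: sup.assoc sup_absorb2)
      then show ?thesis by (simp only:) (rule add_increasing2; simp)
    next
      case False
      then have "sup (V x) (f i x) \<le> block f K k x" by (metis linear)
      then have "sup (sup (block f K k x) (V x)) (f i x) = block f K k x"
        by (simp add: sup.assoc sup_absorb1)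
      also have "\<dots> = block f K (Suc i) x + (block f K k x - block f K (Suc i) x)"
        using le by (simp add: add_diff_inverse_ennreal)
      also have "block f K (Suc i) x \<le> f i x" unfolding block_def using i k(1) by (intro INF_lower) auto
      then have "block f K (Suc i) x + (block f K k x - block f K (Suc i) x) \<le>
          sup (V x) (f i x) + (block f K k x - block f K (Suc i) x)"
        by (intro add_mono le_supI2) auto
      finally show ?thesis .
    qed
    then have "(\<integral>\<^sup>+x. sup (sup (block f K k x) (V x)) (f i x) \<partial>M) \<le>
        (\<integral>\<^sup>+x. sup (V x) (f i x) + (block f K k x - block f K (Suc i) x) \<partial>M)"
      by (rule nn_integral_mono)
    also have "\<dots> = (\<integral>\<^sup>+x. sup (V x) (f i x) \<partial>M) + (\<integral>\<^sup>+x. block f K k x - block f K (Suc i) x \<partial>M)"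
      by (rule nn_integral_add) measurable
    \<comment> \<open>Splitting the integral of a difference requires a finite subtrahend; a
      nonempty block starting at \<open>K\<close> lies under \<open>f K\<close>.\<close>
    also have "(\<integral>\<^sup>+x. block f K k x - block f K (Suc i) x \<partial>M) = a k - a (Suc i)"
      unfolding a_def using fin_a[of "Suc i"] k(1) i le
      by (intro nn_integral_diff) (auto simp: a_def)
    also have "(\<integral>\<^sup>+x. sup (V x) (f i x) \<partial>M) + (a k - a (Suc i)) \<le> ennreal c + ennreal (c' - c)"
    proof (intro add_mono)
      show "(\<integral>\<^sup>+x. sup (V x) (f i x) \<partial>M) \<le> ennreal c" using V i k(1) by simp
      have "I \<le> a (Suc i)" unfolding I_def using i k(1) by (intro INF_lower) auto
      with k(2) have "a k \<le> a (Suc i) + ennreal (c' - c)"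
        by (meson add_right_mono less_imp_le order_trans)
      then show "a k - a (Suc i) \<le> ennreal (c' - c)"
        by (subst ennreal_minus_le_iff) (use fin_a[of "Suc i"] i k(1) in auto)
    qed
    also have "\<dots> = ennreal c'" using c by (simp add: ennreal_plus[symmetric] del: ennreal_plus)
    finally show ?thesis .
  qed
  with k(1) show ?thesis by blast
qed

section \<open>The construction\<close>

lemma rec_nat_psnd: "rec_nat (psnd L) (\<lambda>_ r. psnd r) j = psnd (rec_nat L (\<lambda>_ r. psnd r) j)"
  by (induction j) auto

lemma entry_0: "entry (prod_encode (k, L)) 0 = k"
  by (simp add: entry_def)

lemma entry_Suc: "entry (prod_encode (k, L)) (Suc j) = entry L j"
  using rec_nat_psnd[of "prod_encode (k, L)" j] by (simp add: entry_def)

text \<open>A new threshold shifts the older blocks by one position and adds the block that starts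
  at the former newest threshold. This is the shape in which \<open>ex_threshold\<close>
  applies.\<close>

lemma upper_Suc:
  "upper f (Suc n) (prod_encode (k, L)) i x =
     sup (sup (block f (entry L 0) k x) (SUP j\<in>{..<n}. block f (entry L (Suc j)) (entry L j) x)) (f i x)"
  unfolding upper_def lessThan_Suc_eq_insert_0 by (simp add: entry_0 entry_Suc image_image)

text \<open>
  The thresholds \<open>c n = (\<epsilon> + n \<epsilon>') / (n + 1)\<close> increase strictly from \<open>\<epsilon>\<close> and stay below \<open>\<epsilon>'\<close>.
\<close>

definition numer :: "nat \<Rightarrow> nat \<Rightarrow> nat \<Rightarrow> nat" where
  "numer e e' n = Suc (pfst e) * Suc (psnd e') + n * (Suc (pfst e') * Suc (psnd e))"

definition denom :: "nat \<Rightarrow> nat \<Rightarrow> nat \<Rightarrow> nat" where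
  "denom e e' n = Suc n * (Suc (psnd e) * Suc (psnd e'))"

definition level :: "nat \<Rightarrow> nat \<Rightarrow> nat \<Rightarrow> real" where
  "level e e' n = real (numer e e' n) / real (denom e e' n)"

lemma level_eq:
  "level e e' n = (real_of_rat (pos_rat_of e) + real n * real_of_rat (pos_rat_of e')) / (real n + 1)"
proof -
  have "(a * b' + n * (a' * b)) / ((n + 1) * (b * b')) = (a / b + n * (a' / b')) / (n + 1)"
    if "b > 0" "b' > 0" "n \<ge> 0" for a b a' b' n :: real
    using that by (simp add: divide_simps)
  from this[of "real (Suc (psnd e))" "real (Suc (psnd e'))" "real n" "real (Suc (pfst e))" "real (Suc (pfst e'))"]
  show ?thesis unfolding level_def numer_def denom_def real_pos_rat_of
    by (simp only: of_nat_add of_nat_mult of_nat_Suc add.commute)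
qed

lemma level_0: "level e e' 0 = real_of_rat (pos_rat_of e)"
  by (simp add: level_eq)

lemma level_less_Suc:
  assumes "pos_rat_of e < pos_rat_of e'"
  shows "level e e' n < level e e' (Suc n)"
proof -
  have "(a + n * b) / (n + 1) < (a + (n + 1) * b) / (n + 1 + 1)" if "a < b" "n \<ge> 0" for a b n :: real
    using that by (simp add: divide_simps) (simp add: algebra_simps)
  from this[of "real_of_rat (pos_rat_of e)" "real_of_rat (pos_rat_of e')" "real n"] assms
  show ?thesis by (simp add: level_eq of_rat_less add.commute)
qed

lemma level_le:
  assumes "pos_rat_of e < pos_rat_of e'"
  shows "level e e' n \<le> real_of_rat (pos_rat_of e')"
proof -
  have "(a + n * b) / (n + 1) \<le> b" if "a < b" "n \<ge> 0" for a b n :: real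
    using that by (simp add: divide_simps) (simp add: algebra_simps)
  with assms show ?thesis by (simp add: level_eq of_rat_less)
qed

lemma denom_pos: "0 < denom e e' n"
  by (simp add: denom_def)

lemma level_nonneg: "0 \<le> level e e' n"
  by (simp add: level_def)

context effective_measure_space
begin

text \<open>As in the s-m-n theorem, one oracle program serves all inputs, and \<open>h\<close>
  merely writes the code of that program with the input fixed as a constant.\<close>

theorem ex_uniform_liminf_bound:
  "\<exists>h. \<forall>e e' p f.
     pos_rat_of e < pos_rat_of e' \<and> lower_semicomputes_seq {} B p f \<and>
     (\<forall>i. (\<integral>\<^sup>+ x. f i x \<partial>M) \<le> ennreal (real_of_rat (pos_rat_of e))) \<longrightarrow>
     (\<exists>q \<phi>.
        runs {} h (prod_encode (e, prod_encode (e', code p))) (code q) \<and>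
        lower_semicomputes halting_problem B q \<phi> \<and>
        (\<forall>x. liminf (\<lambda>n. f n x) \<le> \<phi> x) \<and>
        (\<integral>\<^sup>+ x. \<phi> x \<partial>M) \<le> ennreal (real_of_rat (pos_rat_of e')))"
proof -
  obtain R0 where R0: "\<And>p g y. (\<And>m. runs {} p m (g m)) \<Longrightarrow>
      prod_encode (plug_code (code p) R0, y) \<in> halting_problem \<longleftrightarrow> (\<exists>w. exceeds g y w)"
    by (rule ex_halting_test[OF decidable_exceeds]) blast
  obtain R1 where R1: "\<And>p g y. (\<And>m. runs {} p m (g m)) \<Longrightarrow>
      prod_encode (plug_code (code p) R1, y) \<in> halting_problem \<longleftrightarrow> (\<exists>w. block_contains g y w)"
    by (rule ex_halting_test[OF decidable_block_contains]) blast
  \<comment> \<open>This asks whether the candidate threshold \<open>pfst L + Suc d\<close> is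
    violated: does some tail function push the integral with n + 1 blocks above the next
    level?\<close>
  define query where "query = (\<lambda>e e' c n L d. prod_encode (plug_code c R0,
    prod_encode (prod_encode (numer e e' (Suc n), denom e e' (Suc n)),
      prod_encode (Suc n, prod_encode (pfst L + Suc d, L)))))"
  \<comment> \<open>Here \<open>g\<close> will be the characteristic function of the oracle. The
    value 0 means that no violation exists, so minimisation finds the least valid candidate.\<close>
  define search where "search g y = g (query (pfst (pfst (pfst y))) (pfst (psnd (pfst (pfst y))))
    (psnd (psnd (pfst (pfst y)))) (pfst (psnd (pfst y))) (psnd (psnd (pfst y))) (psnd y))" for g :: "nat \<Rightarrow> nat" and y
  have "recursive search"
    unfolding search_def[abs_def] query_def numer_def denom_def
    by (intro recursive_intros recursive_plug_code)
  from ex_search_iteration[OF this] obtain Q where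
    Q: "\<And>A p g a L d n. (\<And>m. runs A p m (g m)) \<Longrightarrow>
      L 0 = prod_encode (0, 0) \<Longrightarrow>
      (\<And>n. L (Suc n) = prod_encode (pfst (L n) + Suc (d n), L n)) \<Longrightarrow>
      (\<And>n. search g (prod_encode (prod_encode (a, prod_encode (n, L n)), d n)) = 0) \<Longrightarrow>
      (\<And>n c. c < d n \<Longrightarrow> search g (prod_encode (prod_encode (a, prod_encode (n, L n)), c)) \<noteq> 0) \<Longrightarrow>
      runs A (plug p Q) (prod_encode (a, n)) (L n)"
    by metis
  \<comment> \<open>The list passed later ends its iteration at index n + 1, so its two newest
    entries delimit block n.\<close>
  define ask where "ask = (\<lambda>c L z. prod_encode (plug_code c R1,
    prod_encode (prod_encode (entry L 1, entry L 0), z)))"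
  \<comment> \<open>\<open>Suc z\<close> codes the basic function whose height and set are packed in
    \<open>z\<close>; a candidate that is not certified is answered by the pause 0.\<close>
  define answer where "answer g y =
    (if g (ask (psnd (psnd (pfst (pfst y)))) (psnd y) (psnd (psnd (pfst y)))) = 0 then 0
     else Suc (psnd (psnd (pfst y))))" for g :: "nat \<Rightarrow> nat" and y
  have "recursive answer"
    unfolding answer_def[abs_def] ask_def entry_def by (intro recursive_intros recursive_plug_code)
  then obtain G where G: "realizes G answer" by (auto simp: recursive_def)
  have "recursive (\<lambda>g y. prod_encode (pfst y, Suc (pfst (psnd y))))" by (intro recursive_intros)
  then obtain J where J: "realizes J (\<lambda>g y. prod_encode (pfst y, Suc (pfst (psnd y))))"
    by (auto simp: recursive_def)
  obtain I where I: "realizes I (\<lambda>g y. y)" using recursive_id by (auto simp: recursive_def)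
  \<comment> \<open>On input (N, (n, z)), \<open>J\<close> requests thresholds up to index n + 1
    from \<open>Q\<close>, and \<open>G\<close> then decides whether \<open>z\<close> is
    listed.\<close>
  define W where "W = Compose G (Fork I (Compose Q J))"
  define prog where "prog N = Compose W (Fork (constant_program N) I)" for N
  have "recursive (\<lambda>g N. code (prog N))"
    unfolding prog_def code.simps
    by (intro recursive_intros recursive_compose[OF recursive_code_constant_program])
  then obtain h where h: "realizes h (\<lambda>g N. code (prog N))" by (auto simp: recursive_def)
  \<comment> \<open>With the empty oracle \<open>Query\<close> computes 0, so filling the hole of
    \<open>h\<close> by \<open>Query\<close> gives \<open>h\<close> itself, run without oracle
    information.\<close>
  have oracle_empty: "runs {} Query m 0" for m using runs.Query[of "{}" m] by simp
  have runs_h: "runs {} h N (code (prog N))" for N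
    using realizesD[OF h oracle_empty] by (simp add: plug_Query)

  define halts :: "nat \<Rightarrow> nat" where "halts n = (if n \<in> halting_problem then 1 else 0)" for n
  have runs_halts: "runs halting_problem Query n (halts n)" for n
    unfolding halts_def by (rule runs.Query)
  have "\<exists>q \<phi>.
      runs {} h (prod_encode (e, prod_encode (e', code p))) (code q) \<and>
      lower_semicomputes halting_problem B q \<phi> \<and>
      (\<forall>x. liminf (\<lambda>n. f n x) \<le> \<phi> x) \<and>
      (\<integral>\<^sup>+ x. \<phi> x \<partial>M) \<le> ennreal (real_of_rat (pos_rat_of e'))"
    if less: "pos_rat_of e < pos_rat_of e'" and p: "lower_semicomputes_seq {} B p f"
      and f: "\<And>i. (\<integral>\<^sup>+ x. f i x \<partial>M) \<le> ennreal (real_of_rat (pos_rat_of e))" for e e' p f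
  proof -
    from p obtain s where s: "\<And>i k. runs {} p (prod_encode (i, k)) (s i k)"
      "\<And>i x. f i x = (SUP k. basic_fun B (s i k) x)" by (auto simp: lower_semicomputes_seq_def)
    define g where "g n = s (pfst n) (psnd n)" for n
    have runs_p: "runs {} p n (g n)" for n using s(1)[of "pfst n" "psnd n"] by (simp add: g_def)
    have f_eq: "f = enumerated B g" by (simp add: fun_eq_iff s(2) enumerated_def g_def)
    have f_meas [measurable]: "f k \<in> borel_measurable M" for k by (simp add: f_eq)
    define N where "N = prod_encode (e, prod_encode (e', code p))"
    define d where "d n L = (LEAST d. search halts (prod_encode (prod_encode (N, prod_encode (n, L)), d)) = 0)" for n L
    define L where "L = rec_nat (prod_encode (0, 0)) (\<lambda>n r. prod_encode (pfst r + Suc (d n r), r))"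
    have L0: "L 0 = prod_encode (0, 0)" and LS: "L (Suc n) = prod_encode (pfst (L n) + Suc (d n (L n)), L n)" for n
      by (simp_all add: L_def)
    define K where "K n = pfst (L n)" for n
    have K_less: "K n < K (Suc n)" for n by (simp add: K_def LS)
    have entry_L: "entry (L n) j = K (n - j)" if "j \<le> n" for n j
      using that
    proof (induction n arbitrary: j)
      case 0
      then show ?case by (simp add: entry_def K_def)
    next
      case (Suc n)
      show ?case
      proof (cases j)
        case 0
        then show ?thesis by (simp add: entry_def K_def)
      next
        case (Suc j')
        then show ?thesis using Suc.IH[of j'] Suc.prems by (simp add: LS entry_Suc)
      qed
    qed
    have decreasing: "entry (L n) (Suc j) < entry (L n) j" if "j < n" for n j
      using that K_less[of "n - Suc j"] by (simp add: entry_L Suc_diff_Suc)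

    have search_iff: "search halts (prod_encode (prod_encode (N, prod_encode (n, L n)), c)) = 0 \<longleftrightarrow>
        (\<forall>i\<ge>K n + Suc c. (\<integral>\<^sup>+x. upper f (Suc n) (prod_encode (K n + Suc c, L n)) i x \<partial>M)
          \<le> ennreal (level e e' (Suc n)))" for n c
    proof -
      let ?L = "prod_encode (K n + Suc c, L n)"
      have dec: "entry ?L (Suc j) < entry ?L j" if "j < Suc n" for j
        using that decreasing[of _ n] by (cases j) (simp_all add: entry_0 entry_Suc entry_L)
      have "search halts (prod_encode (prod_encode (N, prod_encode (n, L n)), c)) = 0 \<longleftrightarrow>
          \<not> (\<exists>w. exceeds g (prod_encode (prod_encode (numer e e' (Suc n), denom e e' (Suc n)),
            prod_encode (Suc n, ?L))) w)"
        by (simp add: search_def query_def N_def halts_def R0[OF runs_p] K_def)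
      also have "\<dots> \<longleftrightarrow> \<not> (\<exists>i\<ge>K n + Suc c. ennreal (level e e' (Suc n)) < (\<integral>\<^sup>+x. upper f (Suc n) ?L i x \<partial>M))"
        using ex_exceeds_iff[of "Suc n" ?L "denom e e' (Suc n)" g "numer e e' (Suc n)", OF dec denom_pos]
        by (simp only: entry_0 f_eq level_def)
      finally show ?thesis by (auto simp: not_less)
    qed
    \<comment> \<open>The invariant at n makes the search at n succeed, and the threshold found
      gives the invariant at n + 1. Thus termination and the integral bound are carried by one
      induction.\<close>
    have found: "\<exists>c. search halts (prod_encode (prod_encode (N, prod_encode (n, L n)), c)) = 0"
      if inv: "\<forall>i\<ge>K n. (\<integral>\<^sup>+x. upper f n (L n) i x \<partial>M) \<le> ennreal (level e e' n)" for n
    proof -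
      have "\<exists>k>K n. \<forall>i\<ge>k. (\<integral>\<^sup>+x. sup (sup (block f (K n) k x)
          (SUP j\<in>{..<n}. block f (entry (L n) (Suc j)) (entry (L n) j) x)) (f i x) \<partial>M)
          \<le> ennreal (level e e' (Suc n))"
      proof (rule ex_threshold[where c = "level e e' n"])
        show "(\<lambda>x. SUP j\<in>{..<n}. block f (entry (L n) (Suc j)) (entry (L n) j) x) \<in> borel_measurable M"
          by (intro borel_measurable_SUP) auto
        show "(\<integral>\<^sup>+x. f (K n) x \<partial>M) < \<infinity>" using f[of "K n"] by (auto intro: le_less_trans)
      qed (use inv level_less_Suc[OF less] level_nonneg in \<open>auto simp: upper_def\<close>)
      then obtain k where k: "K n < k" "\<forall>i\<ge>k. (\<integral>\<^sup>+x. upper f (Suc n) (prod_encode (k, L n)) i x \<partial>M)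
          \<le> ennreal (level e e' (Suc n))"
        by (auto simp: upper_Suc entry_L)
      then obtain c where "k = K n + Suc c" using less_iff_Suc_add by auto
      with k(2) show ?thesis unfolding search_iff by blast
    qed
    have inv: "\<forall>i\<ge>K n. (\<integral>\<^sup>+x. upper f n (L n) i x \<partial>M) \<le> ennreal (level e e' n)" for n
    proof (induction n)
      case 0
      show ?case using f by (simp add: upper_def level_0 bot_ennreal[symmetric])
    next
      case (Suc n)
      from LeastI_ex[OF found[OF Suc]]
      have "search halts (prod_encode (prod_encode (N, prod_encode (n, L n)), d n (L n))) = 0"
        by (simp add: d_def)
      then show ?case unfolding search_iff by (simp add: LS K_def)
    qed

    define v where "v n = block f (K n) (K (Suc n))" for n
    define out where "out k = answer halts (prod_encode (prod_encode (N, k), L (Suc (pfst k))))" for k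
    define \<phi> where "\<phi> x = (SUP k. basic_fun B (out k) x)" for x
    have runs_L: "runs halting_problem Q (prod_encode (N, n)) (L n)" for n
    proof -
      have "runs halting_problem (plug Query Q) (prod_encode (N, n)) (L n)"
      proof (rule Q[where d = "\<lambda>n. d n (L n)"])
        show "search halts (prod_encode (prod_encode (N, prod_encode (n, L n)), d n (L n))) = 0" for n
          unfolding d_def by (rule LeastI_ex[OF found[OF inv]])
        show "search halts (prod_encode (prod_encode (N, prod_encode (n, L n)), c)) \<noteq> 0"
          if "c < d n (L n)" for n c
          using not_less_Least[OF that[unfolded d_def]] .
      qed (use runs_halts L0 LS in auto)
      then show ?thesis by (simp add: plug_Query)
    qed
    have runs_out: "runs halting_problem (prog N) k (out k)" for k
    proof -
      have I': "runs halting_problem I n n" for n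
        using realizesD[OF I runs_halts] by (simp add: plug_Query)
      have J': "runs halting_problem J (prod_encode (N, k)) (prod_encode (N, Suc (pfst k)))"
        using realizesD[OF J runs_halts, of "prod_encode (N, k)"] by (simp add: plug_Query)
      have G': "runs halting_problem G (prod_encode (prod_encode (N, k), L (Suc (pfst k)))) (out k)"
        using realizesD[OF G runs_halts] by (simp add: plug_Query out_def)
      show ?thesis unfolding prog_def W_def
        by (rule runs.Compose[OF runs.Fork[OF runs_constant_program I']
              runs.Compose[OF runs.Fork[OF I' runs.Compose[OF J' runs_L]] G']])
    qed
    have out_eq: "out (prod_encode (n, z)) =
        (if \<exists>t. below_block g t (K n) (K (Suc n)) z then Suc z else 0)" for n z
      by (simp add: out_def answer_def ask_def N_def halts_def R1[OF runs_p] block_contains_def entry_L)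

    have "v n x \<le> \<phi> x" for n x
    proof (rule dense_le)
      fix y assume "y < v n x"
      with ex_below_block[OF _ K_less] obtain t z where
        tz: "below_block g t (K n) (K (Suc n)) z" "x \<in> B (psnd z)" "y < height (pfst z)"
        unfolding v_def f_eq by blast
      then have "out (prod_encode (n, z)) = Suc z" by (auto simp: out_eq)
      then have "basic_fun B (out (prod_encode (n, z))) x = height (pfst z)"
        using tz(2) by (simp add: basic_fun_eq)
      then have "height (pfst z) \<le> \<phi> x" unfolding \<phi>_def by (metis SUP_upper UNIV_I)
      with tz(3) show "y \<le> \<phi> x" by simp
    qed
    \<comment> \<open>Strictly increasing thresholds satisfy n \<le> \<open>K n\<close>, so block n
      is part of the tail from n on and has the larger infimum.\<close>
    moreover have "(INF k\<in>{n..}. f k x) \<le> v n x" for n x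
    proof -
      have "n \<le> K n" using strict_mono_imp_increasing[of K n] K_less by (simp add: strict_mono_Suc_iff)
      then show ?thesis unfolding v_def block_def by (intro INF_superset_mono) auto
    qed
    ultimately have liminf: "liminf (\<lambda>n. f n x) \<le> \<phi> x" for x
      unfolding liminf_SUP_INF by (blast intro: SUP_least order_trans)

    have \<phi>_le: "\<phi> x \<le> (SUP n. SUP j\<in>{..<n}. v j x)" for x
      unfolding \<phi>_def
    proof (rule SUP_least)
      fix k
      obtain n z where k: "k = prod_encode (n, z)" by (metis prod_decode_inverse surj_pair)
      show "basic_fun B (out k) x \<le> (SUP n. SUP j\<in>{..<n}. v j x)"
      proof (cases "basic_fun B (out k) x = 0")
        case False
        then obtain t where below: "below_block g t (K n) (K (Suc n)) z"
          by (auto simp: k out_eq basic_fun_eq split: if_splits)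
        then have "out k = Suc z" by (auto simp: k out_eq)
        with False below have t: "below_block g t (K n) (K (Suc n)) z" "x \<in> B (psnd z)"
          "basic_fun B (out k) x = height (pfst z)"
          by (simp_all add: basic_fun_eq split: if_splits)
        have "height (pfst z) \<le> v n x" unfolding v_def f_eq by (rule below_block_le[OF t(1,2)])
        also have "\<dots> \<le> (SUP j\<in>{..<Suc n}. v j x)" by (rule SUP_upper) simp
        also have "\<dots> \<le> (SUP n. SUP j\<in>{..<n}. v j x)" by (rule SUP_upper) simp
        finally show ?thesis by (simp add: t(3))
      qed simp
    qed
    have partial: "(\<integral>\<^sup>+x. (SUP j\<in>{..<n}. v j x) \<partial>M) \<le> ennreal (real_of_rat (pos_rat_of e'))" for n
    proof -
      \<comment> \<open>\<open>K n\<close> is the first tail index covered by the invariant. The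
        list has its newest block at position 0, hence the reversal from j to
        \<open>n - Suc j\<close>.\<close>
      have "(SUP j\<in>{..<n}. v j x) \<le> upper f n (L n) (K n) x" for x
      proof (rule SUP_least)
        fix j assume "j \<in> {..<n}"
        then have "v j x = block f (entry (L n) (Suc (n - Suc j))) (entry (L n) (n - Suc j)) x"
          by (simp add: v_def entry_L Suc_diff_Suc)
        with \<open>j \<in> {..<n}\<close> show "v j x \<le> upper f n (L n) (K n) x"
          unfolding upper_def by (intro le_supI1 SUP_upper2[of "n - Suc j"]) auto
      qed
      then have "(\<integral>\<^sup>+x. (SUP j\<in>{..<n}. v j x) \<partial>M) \<le> (\<integral>\<^sup>+x. upper f n (L n) (K n) x \<partial>M)"
        by (rule nn_integral_mono)
      also have "\<dots> \<le> ennreal (level e e' n)" using inv by blast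
      also have "\<dots> \<le> ennreal (real_of_rat (pos_rat_of e'))" by (intro ennreal_leI level_le less)
      finally show ?thesis .
    qed
    have "(\<integral>\<^sup>+x. \<phi> x \<partial>M) \<le> (\<integral>\<^sup>+x. (SUP n. SUP j\<in>{..<n}. v j x) \<partial>M)"
      by (intro nn_integral_mono \<phi>_le)
    also have "\<dots> = (SUP n. \<integral>\<^sup>+x. (SUP j\<in>{..<n}. v j x) \<partial>M)"
      by (intro nn_integral_monotone_convergence_SUP borel_measurable_SUP)
        (auto simp: incseq_def le_fun_def v_def intro!: SUP_subset_mono)
    also have "\<dots> \<le> ennreal (real_of_rat (pos_rat_of e'))" by (intro SUP_least partial)
    finally have integral: "(\<integral>\<^sup>+x. \<phi> x \<partial>M) \<le> ennreal (real_of_rat (pos_rat_of e'))" .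
    have "lower_semicomputes halting_problem B (prog N) \<phi>"
      unfolding lower_semicomputes_def using runs_out by (auto simp: \<phi>_def)
    with runs_h[of N] liminf integral show ?thesis unfolding N_def by blast
  qed
  then show ?thesis by (intro exI[of _ h]) blast
qed

theorem ex_liminf_bound:
  assumes \<epsilon>: "0 < \<epsilon>" "\<epsilon> < \<epsilon>'" and f: "lower_semicomputable_seq {} B f"
    and int: "\<And>i. (\<integral>\<^sup>+ x. f i x \<partial>M) \<le> ennreal (real_of_rat \<epsilon>)"
  shows "\<exists>\<phi>. lower_semicomputable halting_problem B \<phi> \<and>
    (\<forall>x. liminf (\<lambda>n. f n x) \<le> \<phi> x) \<and> (\<integral>\<^sup>+ x. \<phi> x \<partial>M) \<le> ennreal (real_of_rat \<epsilon>')"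
proof -
  have "\<epsilon> \<in> range pos_rat_of" "\<epsilon>' \<in> range pos_rat_of" using \<epsilon> by (auto simp: range_pos_rat_of)
  then obtain e e' where e: "\<epsilon> = pos_rat_of e" "\<epsilon>' = pos_rat_of e'" by blast
  from f obtain p where "lower_semicomputes_seq {} B p f" by (auto simp: lower_semicomputable_seq_def)
  with \<epsilon> int ex_uniform_liminf_bound show ?thesis
    unfolding e lower_semicomputable_def by meson
qed

end

section \<open>Grids on the three spaces\<close>

text \<open>Points are atoms of measure 1, so the cells of resolution S are the points below S, and
  one more than the sum of a finite set bounds its elements.\<close>

interpretation nat_space: effective_measure_space "count_space UNIV" nat_basic "(=)" "\<lambda>S m. m" "\<lambda>S. S" "\<lambda>S. 1"
proof
  fix F :: "nat set" assume "finite F"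
  then have "v < Suc (\<Sum>F)" if "v \<in> F" for v using member_le_sum[of v F id] that by simp
  then show "\<exists>S. AE x in count_space UNIV. \<forall>v\<in>F. x \<in> nat_basic v \<longrightarrow> (\<exists>m<S. x \<in> nat_basic m \<and> m = v)"
    by (intro exI[of _ "Suc (\<Sum>F)"]) (auto simp: nat_basic_def)
next
  show "decidable (\<lambda>g z. pfst z = psnd z)" by (intro recursive_intros)
qed (auto simp: nat_basic_def intro: recursive_intros)

section \<open>Cantor space, with the strings of length S as cells\<close>

lemma cantor_basic_eq: "cantor_basic u = {\<omega>. \<forall>i<pfst u. \<omega> i = bit (psnd u) i}"
  by (auto simp: cantor_basic_def cylinder_def string_of_def split: prod.split)

text \<open>The number in a code may have binary digits beyond the coded length, so only the digits
  below \<open>pfst v\<close> are compared.\<close>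

definition cantor_sub :: "nat \<Rightarrow> nat \<Rightarrow> bool" where
  "cantor_sub u v \<longleftrightarrow> pfst v \<le> pfst u \<and> (\<forall>i<pfst v. bit (psnd u) i = bit (psnd v) i)"

lemma bit_eq_iff_div_mod: "bit m i = bit m' i \<longleftrightarrow> m div 2 ^ i mod 2 = m' div 2 ^ i mod (2 :: nat)"
  by (auto simp: bit_iff_odd mod2_eq_if)

lemma emeasure_cantor_basic:
  "cantor_basic u \<in> sets cantor_measure"
  "emeasure cantor_measure (cantor_basic u) = ennreal (1 / 2 ^ pfst u)"
proof -
  let ?P = "measure_pmf (bernoulli_pmf (1 / 2))"
  interpret product_prob_space "\<lambda>_. ?P" "UNIV :: nat set" ..
  have eq: "cantor_basic u = {\<omega> \<in> space (PiM UNIV (\<lambda>_. ?P)). \<forall>i\<in>{..<pfst u}. \<omega> i \<in> {bit (psnd u) i}}"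
    by (auto simp: cantor_basic_eq space_PiM)
  show "cantor_basic u \<in> sets cantor_measure"
    unfolding eq cantor_measure_def
  proof (rule sets.sets_Collect_finite_All)
    fix i
    have "(\<lambda>\<omega>. \<omega> i) -` {bit (psnd u) i} \<inter> space (PiM UNIV (\<lambda>_. ?P)) \<in> sets (PiM UNIV (\<lambda>_. ?P))"
      by (rule measurable_sets[OF measurable_component_singleton]) auto
    then show "{\<omega> \<in> space (PiM UNIV (\<lambda>_. ?P)). \<omega> i \<in> {bit (psnd u) i}} \<in> sets (PiM UNIV (\<lambda>_. ?P))"
      by (simp add: vimage_def Int_def conj_commute)
  qed simp
  have half: "emeasure ?P {b} = ennreal (1 / 2)" for b
    by (cases b) (simp_all add: emeasure_pmf_single)
  have "emeasure (PiM UNIV (\<lambda>_. ?P)) (cantor_basic u) = (\<Prod>i<pfst u. emeasure ?P {bit (psnd u) i})"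
    unfolding eq by (rule emeasure_PiM_Collect) auto
  also have "\<dots> = ennreal (1 / 2) ^ pfst u" by (simp add: half)
  also have "\<dots> = ennreal (1 / 2 ^ pfst u)" by (subst ennreal_power) (simp_all add: power_one_over)
  finally show "emeasure cantor_measure (cantor_basic u) = ennreal (1 / 2 ^ pfst u)"
    by (simp add: cantor_measure_def)
qed

interpretation cantor_space: effective_measure_space cantor_measure cantor_basic cantor_sub
  "\<lambda>S m. prod_encode (S, m)" "\<lambda>S. 2 ^ S" "\<lambda>S. 2 ^ S"
proof
  show "cantor_basic u \<in> sets cantor_measure" for u by (rule emeasure_cantor_basic)
  show "cantor_sub u v \<Longrightarrow> cantor_basic u \<subseteq> cantor_basic v" for u v
    by (auto simp: cantor_sub_def cantor_basic_eq)
  show "cantor_sub u v \<Longrightarrow> cantor_sub v w \<Longrightarrow> cantor_sub u w" for u v w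
    by (auto simp: cantor_sub_def)
  show "\<exists>u. x \<in> cantor_basic u \<and> cantor_sub u v \<and> cantor_sub u w"
    if "x \<in> cantor_basic v" "x \<in> cantor_basic w" for x v w
  proof (cases "pfst v \<le> pfst w")
    case True
    with that show ?thesis by (intro exI[of _ w]) (auto simp: cantor_sub_def cantor_basic_eq)
  next
    case False
    with that show ?thesis by (intro exI[of _ v]) (auto simp: cantor_sub_def cantor_basic_eq)
  qed
  show "cantor_basic (prod_encode (S, m)) \<inter> cantor_basic (prod_encode (S, m')) = {}"
    if "m < 2 ^ S" "m' < 2 ^ S" "m \<noteq> m'" for S m m'
  proof -
    have "take_bit S m \<noteq> take_bit S m'" using that by (simp add: take_bit_nat_eq_self)
    then obtain i where "i < S" "bit m i \<noteq> bit m' i" by (auto simp: bit_eq_iff bit_take_bit_iff)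
    then show ?thesis by (auto simp: cantor_basic_eq)
  qed
  show "emeasure cantor_measure (cantor_basic (prod_encode (S, m))) = ennreal (1 / real (2 ^ S))" for S m
    by (simp add: emeasure_cantor_basic)
  fix F :: "nat set" assume F: "finite F"
  define S where "S = (\<Sum>v\<in>F. pfst v)"
  have S: "pfst v \<le> S" if "v \<in> F" for v unfolding S_def using F that by (intro member_le_sum) auto
  have "\<exists>m<2 ^ S. x \<in> cantor_basic (prod_encode (S, m)) \<and> cantor_sub (prod_encode (S, m)) v"
    if v: "v \<in> F" "x \<in> cantor_basic v" for v x
  proof -
    define m :: nat where "m = horner_sum of_bool 2 (map x [0..<S])"
    have bit: "bit m i = x i" if "i < S" for i using that by (simp add: m_def bit_horner_sum_bit_iff)
    have "m < 2 ^ S" using horner_sum_of_bool_2_less[of "map x [0..<S]"] by (simp add: m_def)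
    with bit v S[OF v(1)] show ?thesis by (intro exI[of _ m]) (auto simp: cantor_basic_eq cantor_sub_def)
  qed
  then show "\<exists>S. AE x in cantor_measure. \<forall>v\<in>F. x \<in> cantor_basic v \<longrightarrow>
      (\<exists>m<2 ^ S. x \<in> cantor_basic (prod_encode (S, m)) \<and> cantor_sub (prod_encode (S, m)) v)"
    by (intro exI[of _ S]) auto
next
  show "decidable (\<lambda>g z. cantor_sub (pfst z) (psnd z))"
    unfolding cantor_sub_def bit_eq_iff_div_mod by (intro recursive_intros)
qed (auto simp: cantor_measure_def space_PiM intro: recursive_intros)

section \<open>The real line, with intervals of length 1 / (S + 1) as cells\<close>

lemma real_basic_eq:
  "real_basic u = {real_of_rat (rat_of (pfst u)) <..< real_of_rat (rat_of (psnd u))}"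
  by (simp add: real_basic_def split: prod.split)

definition real_sub :: "nat \<Rightarrow> nat \<Rightarrow> bool" where
  "real_sub u v \<longleftrightarrow> rat_of (pfst v) \<le> rat_of (pfst u) \<and> rat_of (psnd u) \<le> rat_of (psnd v)"

lemma real_rat_of: "real_of_rat (rat_of n) = real_of_int (int_decode (pfst n)) / real (Suc (psnd n))"
  by (simp add: rat_of_def of_rat_divide of_rat_add split: prod.split)

lemma int_decode_mod_div: "int_decode n = (if n mod 2 = 0 then int (n div 2) else - int (Suc (n div 2)))"
  by (auto simp: int_decode_def sum_decode_def even_iff_mod_2_eq_zero)

lemma decidable_rat_of_le:
  assumes "recursive F" "recursive G"
  shows "decidable (\<lambda>g n. rat_of (F g n) \<le> rat_of (G g n))"
proof -
  \<comment> \<open>The functionals compute naturals, but numerators are integers. Splitting each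
    into positive and negative parts and moving the negative ones across leaves an inequality of
    naturals.\<close>
  define pos where "pos n = (if n mod 2 = 0 then n div 2 else 0)" for n :: nat
  define neg where "neg n = (if n mod 2 = 0 then 0 else Suc (n div 2))" for n :: nat
  have int: "int_decode n = int (pos n) - int (neg n)" for n
    by (simp add: int_decode_mod_div pos_def neg_def)
  have frac: "a / b \<le> c / d \<longleftrightarrow> a * d \<le> c * b" if "0 < b" "0 < d" for a b c d :: real
    using that by (simp add: field_simps)
  have "rat_of a \<le> rat_of b \<longleftrightarrow>
      pos (pfst a) * Suc (psnd b) + neg (pfst b) * Suc (psnd a) \<le>
      pos (pfst b) * Suc (psnd a) + neg (pfst a) * Suc (psnd b)" for a b
  proof -
    have "rat_of a \<le> rat_of b \<longleftrightarrow> real_of_rat (rat_of a) \<le> real_of_rat (rat_of b)"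
      by (simp add: of_rat_less_eq)
    also have "\<dots> \<longleftrightarrow> (real (pos (pfst a)) - real (neg (pfst a))) * real (Suc (psnd b)) \<le>
        (real (pos (pfst b)) - real (neg (pfst b))) * real (Suc (psnd a))"
      unfolding real_rat_of int by (subst frac) auto
    also have "\<dots> \<longleftrightarrow> real (pos (pfst a) * Suc (psnd b) + neg (pfst b) * Suc (psnd a)) \<le>
        real (pos (pfst b) * Suc (psnd a) + neg (pfst a) * Suc (psnd b))"
      unfolding of_nat_add of_nat_mult by (simp only: left_diff_distrib) linarith
    finally show ?thesis by (simp only: of_nat_le_iff)
  qed
  then show ?thesis unfolding pos_def neg_def by (simp only:) (intro recursive_intros assms)
qed

text \<open>
  Since \<^const>\<open>int_decode\<close> lists \<open>0, -1, 1, -2, 2, \<dots>\<close>, the cell with index \<open>m\<close> at resolution \<open>S\<close> has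
  left endpoint number \<open>m\<close>, and its right endpoint is the next integer over the same denominator
  (truncated subtraction takes care of the step from \<open>-1\<close> to \<open>0\<close>).
\<close>

definition real_cell :: "nat \<Rightarrow> nat \<Rightarrow> nat" where
  "real_cell S m = prod_encode (prod_encode (m, S), prod_encode (if m mod 2 = 0 then m + 2 else m - 2, S))"

lemma int_decode_next: "int_decode (if m mod 2 = 0 then m + 2 else m - 2) = int_decode m + 1"
proof (cases "m mod 2 = 0")
  case False
  show ?thesis
  proof (cases "m = 1")
    case False
    with \<open>m mod 2 \<noteq> 0\<close> have "m > 2" by (cases m; cases "m - 1"; auto)
    then obtain j where "m = j + 2" using less_imp_add_positive by (metis add.commute)
    with \<open>m mod 2 \<noteq> 0\<close> show ?thesis by (simp add: int_decode_mod_div)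
  qed (simp add: int_decode_mod_div)
qed (simp add: int_decode_mod_div)

lemma real_basic_cell:
  "real_basic (real_cell S m) =
    {real_of_int (int_decode m) / real (Suc S) <..< (real_of_int (int_decode m) + 1) / real (Suc S)}"
  unfolding real_basic_eq real_rat_of by (simp add: real_cell_def int_decode_next del: of_nat_Suc)

text \<open>One number both clears all denominators, so that endpoints are grid points, and bounds
  all endpoints, so that the cells reach them. Both properties pass to positive multiples, which
  drives the induction.\<close>

lemma ex_common_grid:
  assumes "finite Q"
  shows "\<exists>D>0. \<forall>n\<in>Q. real_of_rat (rat_of n) * real D \<in> \<int> \<and> \<bar>real_of_rat (rat_of n)\<bar> \<le> real D"
  using assms
proof (induction rule: finite_induct)
  case empty
  show ?case by (auto intro: exI[of _ 1])
next
  case (insert n Q)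
  then obtain D where D: "D > 0"
    "\<And>n. n \<in> Q \<Longrightarrow> real_of_rat (rat_of n) * real D \<in> \<int> \<and> \<bar>real_of_rat (rat_of n)\<bar> \<le> real D" by blast
  define b where "b = Suc (psnd n)"
  obtain k where k: "\<bar>real_of_rat (rat_of n)\<bar> \<le> real k" using real_arch_simple by blast
  define D' where "D' = D * (b * Suc k)"
  have int: "real_of_rat (rat_of n) * real D' \<in> \<int>"
  proof -
    have "real D' = real b * real (D * Suc k)" by (simp add: D'_def algebra_simps)
    then have "real_of_rat (rat_of n) * real D' = real_of_int (int_decode (pfst n)) * real (D * Suc k)"
      unfolding real_rat_of b_def[symmetric] by (simp add: b_def)
    then have "real_of_rat (rat_of n) * real D' = real_of_int (int_decode (pfst n) * int (D * Suc k))"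
      by (simp only: of_int_mult of_int_of_nat_eq)
    then show ?thesis by (metis Ints_of_int)
  qed
  have "D' > 0" using D(1) by (simp add: D'_def b_def)
  then have "Suc k \<le> D'" "D \<le> D'" by (auto simp: D'_def intro!: dvd_imp_le simp del: mult_Suc_right)
  then have le: "real k \<le> real D'" "real D \<le> real D'" by simp_all
  have "real_of_rat (rat_of m) * real D' \<in> \<int> \<and> \<bar>real_of_rat (rat_of m)\<bar> \<le> real D'" if "m \<in> Q" for m
  proof -
    have "real_of_rat (rat_of m) * real D' = (real_of_rat (rat_of m) * real D) * real (b * Suc k)"
      by (simp only: D'_def of_nat_mult mult.assoc)
    then have "real_of_rat (rat_of m) * real D' \<in> \<int>"
      using D(2)[OF that] by (metis Ints_mult Ints_of_nat)
    then show ?thesis using D(2)[OF that] le by auto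
  qed
  with int k le D(1) show ?case by (intro exI[of _ D']) (auto simp: D'_def b_def)
qed

text \<open>The 2 (S + 1)^2 cells fill the interval from -(S + 1) to S + 1 except for grid points,
  so a single parameter refines the mesh and widens the range.\<close>

interpretation real_space: effective_measure_space lebesgue real_basic real_sub
  real_cell "\<lambda>S. 2 * Suc S ^ 2" Suc
proof
  show "real_sub u v \<Longrightarrow> real_basic u \<subseteq> real_basic v" for u v
    by (auto simp: real_sub_def real_basic_eq of_rat_less_eq[symmetric, where ?'a = real])
  show "real_sub u v \<Longrightarrow> real_sub v w \<Longrightarrow> real_sub u w" for u v w
    by (auto simp: real_sub_def)
  show "\<exists>u. x \<in> real_basic u \<and> real_sub u v \<and> real_sub u w"
    if "x \<in> real_basic v" "x \<in> real_basic w" for x v w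
  proof -
    define a where "a = (if rat_of (pfst v) \<le> rat_of (pfst w) then pfst w else pfst v)"
    define b where "b = (if rat_of (psnd v) \<le> rat_of (psnd w) then psnd v else psnd w)"
    from that show ?thesis
      by (intro exI[of _ "prod_encode (a, b)"]) (auto simp: real_basic_eq real_sub_def a_def b_def)
  qed
  show "real_basic (real_cell S m) \<inter> real_basic (real_cell S m') = {}" if "m \<noteq> m'" for S m m'
  proof -
    have ne: "int_decode m \<noteq> int_decode m'" using that by (simp add: int_decode_eq)
    have False if x: "x \<in> real_basic (real_cell S m)" "x \<in> real_basic (real_cell S m')" for x
    proof -
      have "\<lfloor>x * real (Suc S)\<rfloor> = int_decode k" if "x \<in> real_basic (real_cell S k)" for k
        using that unfolding real_basic_cell
        by (intro floor_unique) (auto simp: pos_divide_less_eq pos_less_divide_eq simp del: of_nat_Suc)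
      with x ne show False by metis
    qed
    then show ?thesis by blast
  qed
  show "emeasure lebesgue (real_basic (real_cell S m)) = ennreal (1 / real (Suc S))" for S m
    unfolding real_basic_cell by (simp add: divide_right_mono add_divide_distrib del: of_nat_Suc)
  fix F :: "nat set" assume F: "finite F"
  then obtain D where D: "D > 0" "\<And>n. n \<in> pfst ` F \<union> psnd ` F \<Longrightarrow>
      real_of_rat (rat_of n) * real D \<in> \<int> \<and> \<bar>real_of_rat (rat_of n)\<bar> \<le> real D"
    using ex_common_grid[of "pfst ` F \<union> psnd ` F"] by auto
  define S where "S = D - 1"
  have S: "Suc S = D" using D(1) by (simp add: S_def)
  \<comment> \<open>Grid points belong to no open cell; being countable, they form a null
    set.\<close>
  have "countable (range (\<lambda>i. real_of_int i / real D))" by simp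
  then have "AE x in lebesgue. x \<notin> range (\<lambda>i. real_of_int i / real D)"
    by (intro AE_not_in) (simp add: countable_imp_null_set_lborel null_sets_completionI)
  moreover have "\<exists>m<2 * Suc S ^ 2. x \<in> real_basic (real_cell S m) \<and> real_sub (real_cell S m) v"
    if x: "x \<notin> range (\<lambda>i. real_of_int i / real D)" and v: "v \<in> F" "x \<in> real_basic v" for x v
  proof -
    define i where "i = \<lfloor>x * real D\<rfloor>"
    define m where "m = int_encode i"
    have "real_of_int i \<noteq> x * real D"
    proof
      assume "real_of_int i = x * real D"
      then have "x = real_of_int i / real D" using D(1) by simp
      with x show False by blast
    qed
    then have i: "real_of_int i < x * real D" "x * real D < real_of_int i + 1"
      unfolding i_def by linarith+
    have x_cell: "x \<in> real_basic (real_cell S m)"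
      unfolding real_basic_cell S m_def using i D(1) by (simp add: pos_divide_less_eq pos_less_divide_eq)
    obtain a where a: "real_of_rat (rat_of (pfst v)) * real D = real_of_int a"
      using D(2)[of "pfst v"] v(1) by (auto elim: Ints_cases)
    obtain b where b: "real_of_rat (rat_of (psnd v)) * real D = real_of_int b"
      using D(2)[of "psnd v"] v(1) by (auto elim: Ints_cases)
    have "real_of_int a < x * real D" "x * real D < real_of_int b"
      using v(2) D(1) by (simp_all add: a[symmetric] b[symmetric] real_basic_eq)
    with i have ab: "a \<le> i" "i + 1 \<le> b" by linarith+
    have bound: "\<bar>real_of_rat (rat_of n) * real D\<bar> \<le> real (D ^ 2)" if "n \<in> pfst ` F \<union> psnd ` F" for n
      using D(2)[OF that] by (auto simp: abs_mult power2_eq_square intro: mult_right_mono)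
    have "\<bar>real_of_int a\<bar> \<le> real (D ^ 2)" "\<bar>real_of_int b\<bar> \<le> real (D ^ 2)"
      using bound[of "pfst v"] bound[of "psnd v"] v(1) unfolding a b by auto
    then have "- int (D ^ 2) \<le> a" "b \<le> int (D ^ 2)" by linarith+
    with ab have "- int (D ^ 2) \<le> i" "i < int (D ^ 2)" by linarith+
    \<comment> \<open>\<open>int_encode\<close> sends nonnegative integers to even and negative ones
      to odd numbers, so the integers from -E to E - 1 receive exactly the codes below 2 E. It is
      used with E = D^2.\<close>
    moreover have "m < 2 * E" if "- int E \<le> i" "i < int E" for E
      using that by (auto simp: m_def int_encode_def sum_encode_def)
    ultimately have "m < 2 * D ^ 2" by blast
    moreover have "real_sub (real_cell S m) v"
    proof -
      have "real_of_rat (rat_of (pfst v)) = real_of_int a / real D"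
        "real_of_rat (rat_of (psnd v)) = real_of_int b / real D"
        using a b D(1) by (simp_all add: field_simps)
      moreover have "real_of_rat (rat_of (pfst (real_cell S m))) = real_of_int i / real D"
        "real_of_rat (rat_of (psnd (real_cell S m))) = real_of_int (i + 1) / real D"
        unfolding real_rat_of by (simp_all add: real_cell_def int_decode_next m_def S del: of_nat_Suc)
      ultimately show ?thesis
        unfolding real_sub_def of_rat_less_eq[symmetric, where ?'a = real]
        using ab by (auto intro!: divide_right_mono simp del: of_int_add)
    qed
    ultimately show ?thesis using x_cell unfolding S by blast
  qed
  ultimately show "\<exists>S. AE x in lebesgue. \<forall>v\<in>F. x \<in> real_basic v \<longrightarrow>
      (\<exists>m<2 * (Suc S)\<^sup>2. x \<in> real_basic (real_cell S m) \<and> real_sub (real_cell S m) v)"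
    by (intro exI[of _ S]) (auto elim: eventually_mono)
next
  show "decidable (\<lambda>g z. real_sub (pfst z) (psnd z))"
    unfolding real_sub_def by (intro recursive_intros decidable_rat_of_le)
  show "recursive (\<lambda>g z. real_cell (pfst z) (psnd z))"
    unfolding real_cell_def by (intro recursive_intros)
  show "recursive (\<lambda>g S. 2 * (Suc S)\<^sup>2)" by (intro recursive_intros)
qed (auto simp: real_basic_eq intro: recursive_intros)

theorem theorem10:
  shows
    "((\<forall>(\<epsilon>::rat) (f :: nat \<Rightarrow> (nat \<Rightarrow> bool) \<Rightarrow> ennreal).
         0 < \<epsilon> \<and> lower_semicomputable_seq {} cantor_basic f \<and>
         (\<forall>i. (\<integral>\<^sup>+ x. f i x \<partial>cantor_measure) \<le> ennreal (real_of_rat \<epsilon>)) \<longrightarrow>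
         (\<forall>\<epsilon>'>\<epsilon>. \<exists>\<phi>.
            lower_semicomputable halting_problem cantor_basic \<phi> \<and>
            (\<forall>x. liminf (\<lambda>n. f n x) \<le> \<phi> x) \<and>
            (\<integral>\<^sup>+ x. \<phi> x \<partial>cantor_measure) \<le> ennreal (real_of_rat \<epsilon>'))) \<and>
      (\<exists>h. \<forall>e e' p (f :: nat \<Rightarrow> (nat \<Rightarrow> bool) \<Rightarrow> ennreal).
         pos_rat_of e < pos_rat_of e' \<and> lower_semicomputes_seq {} cantor_basic p f \<and>
         (\<forall>i. (\<integral>\<^sup>+ x. f i x \<partial>cantor_measure) \<le> ennreal (real_of_rat (pos_rat_of e))) \<longrightarrow>
         (\<exists>q \<phi>.
            runs {} h (prod_encode (e, prod_encode (e', code p))) (code q) \<and>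
            lower_semicomputes halting_problem cantor_basic q \<phi> \<and>
            (\<forall>x. liminf (\<lambda>n. f n x) \<le> \<phi> x) \<and>
            (\<integral>\<^sup>+ x. \<phi> x \<partial>cantor_measure) \<le> ennreal (real_of_rat (pos_rat_of e'))))) \<and>
     ((\<forall>(\<epsilon>::rat) (f :: nat \<Rightarrow> nat \<Rightarrow> ennreal).
         0 < \<epsilon> \<and> lower_semicomputable_seq {} nat_basic f \<and>
         (\<forall>i. (\<integral>\<^sup>+ x. f i x \<partial>count_space UNIV) \<le> ennreal (real_of_rat \<epsilon>)) \<longrightarrow>
         (\<forall>\<epsilon>'>\<epsilon>. \<exists>\<phi>.
            lower_semicomputable halting_problem nat_basic \<phi> \<and>
            (\<forall>x. liminf (\<lambda>n. f n x) \<le> \<phi> x) \<and>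
            (\<integral>\<^sup>+ x. \<phi> x \<partial>count_space UNIV) \<le> ennreal (real_of_rat \<epsilon>'))) \<and>
      (\<exists>h. \<forall>e e' p (f :: nat \<Rightarrow> nat \<Rightarrow> ennreal).
         pos_rat_of e < pos_rat_of e' \<and> lower_semicomputes_seq {} nat_basic p f \<and>
         (\<forall>i. (\<integral>\<^sup>+ x. f i x \<partial>count_space UNIV) \<le> ennreal (real_of_rat (pos_rat_of e))) \<longrightarrow>
         (\<exists>q \<phi>.
            runs {} h (prod_encode (e, prod_encode (e', code p))) (code q) \<and>
            lower_semicomputes halting_problem nat_basic q \<phi> \<and>
            (\<forall>x. liminf (\<lambda>n. f n x) \<le> \<phi> x) \<and>
            (\<integral>\<^sup>+ x. \<phi> x \<partial>count_space UNIV) \<le> ennreal (real_of_rat (pos_rat_of e'))))) \<and>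
     ((\<forall>(\<epsilon>::rat) (f :: nat \<Rightarrow> real \<Rightarrow> ennreal).
         0 < \<epsilon> \<and> lower_semicomputable_seq {} real_basic f \<and>
         (\<forall>i. (\<integral>\<^sup>+ x. f i x \<partial>lebesgue) \<le> ennreal (real_of_rat \<epsilon>)) \<longrightarrow>
         (\<forall>\<epsilon>'>\<epsilon>. \<exists>\<phi>.
            lower_semicomputable halting_problem real_basic \<phi> \<and>
            (\<forall>x. liminf (\<lambda>n. f n x) \<le> \<phi> x) \<and>
            (\<integral>\<^sup>+ x. \<phi> x \<partial>lebesgue) \<le> ennreal (real_of_rat \<epsilon>'))) \<and>
      (\<exists>h. \<forall>e e' p (f :: nat \<Rightarrow> real \<Rightarrow> ennreal).
         pos_rat_of e < pos_rat_of e' \<and> lower_semicomputes_seq {} real_basic p f \<and>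
         (\<forall>i. (\<integral>\<^sup>+ x. f i x \<partial>lebesgue) \<le> ennreal (real_of_rat (pos_rat_of e))) \<longrightarrow>
         (\<exists>q \<phi>.
            runs {} h (prod_encode (e, prod_encode (e', code p))) (code q) \<and>
            lower_semicomputes halting_problem real_basic q \<phi> \<and>
            (\<forall>x. liminf (\<lambda>n. f n x) \<le> \<phi> x) \<and>
            (\<integral>\<^sup>+ x. \<phi> x \<partial>lebesgue) \<le> ennreal (real_of_rat (pos_rat_of e')))))"
  by (intro conjI allI impI; (elim conjE)?;
      (rule cantor_space.ex_uniform_liminf_bound nat_space.ex_uniform_liminf_bound
        real_space.ex_uniform_liminf_bound |
       rule cantor_space.ex_liminf_bound nat_space.ex_liminf_bound real_space.ex_liminf_bound; blast))

end
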